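(* Let $K$ be a field of characteristic $0$, $d\ge2$, and let $\beta=(\beta_1,\beta_2)\in K^2$, $\beta\ne(0,0)$, with $\beta_1+\beta_2=0$. In $G_d(\mathfrak V_\beta)$ the consequences of degree $n+1$ of the following polynomials of degree $n$ are equivalent to the polynomials listed (with $\gamma_1,\gamma_2\in K$): (i) for $w_{(1)}=x_1$: $w_{(2)}^{(1)}=y_1z_1$, $w_{(1^2)}^{(0)}=y_1z_2-y_2z_1$; (ii) for $w_{(2)}^{(1)}=y_1z_1$: $w_{(3)}^{(2)}=y_1^2z_1$, $w_{(3)}^{(1)}=y_1z_1^2$, $w_{(2,1)}^{(1)}$; (iii) for $w_{(n)}=\gamma_1w_{(n)}^{(n-1)}+\gamma_2w_{(n)}^{(n-2)}$, $n\ge3$, $\gamma_1+\gamma_2\ne0$: $w_{(n+1)}^{(n)}$, $w_{(n+1)}^{(n-1)}$, $w_{(n,1)}^{(n-1)}$; (iv) for $w_{(n)}=w_{(n)}^{(n-1)}-w_{(n)}^{(n-2)}$, $n\ge3$: $w_{(n+1)}^{(n)}-w_{(n+1)}^{(n-1)}$, $w_{(n,1)}^{(n-1)}$; (v) for $w_{(n-1,1)}^{(n-2)}$, $n\ge3$: $w_{(n+1)}^{(n-1)}-w_{(n+1)}^{(n-2)}$, $w_{(n,1)}^{(n-1)}$.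
   Context: A bicommutative algebra is a nonassociative $K$-algebra satisfying $(x_1x_2)x_3=(x_1x_3)x_2$ and $x_1(x_2x_3)=x_2(x_1x_3)$; $\mathfrak B$ is the variety of all of them. The free bicommutative algebra $F_d(\mathfrak B)$ on $x_1,\dots,x_d$ is identified (via $x_i\mapsto x_i$) with the algebra $G_d$ having as basis $x_1,\dots,x_d$ together with all monomials $Y^aZ^b=y_1^{a_1}\cdots y_d^{a_d}z_1^{b_1}\cdots z_d^{b_d}$ in the polynomial algebra $K[y_1,\dots,y_d,z_1,\dots,z_d]$ with $|a|\ge1$ and $|b|\ge1$, and multiplication $x_ix_j=y_iz_j$, $x_i(Y^aZ^b)=y_iY^aZ^b$, $(Y^aZ^b)x_i=Y^aZ^bz_i$, $(Y^aZ^b)(Y^cZ^e)=Y^{a+c}Z^{b+e}$. The group $GL_d(K)$ acts on $G_d$ by automorphisms extending its linear action on the span of $x_1,\dots,x_d$. Put $w_{(1)}=x_1$, $w_{(n)}^{(j)}=y_1^jz_1^{n-j}$ ($1\le j\le n-1$), and $w_{(\lambda_1,\lambda_2)}^{(j)}=y_1^j(y_1z_2-y_2z_1)^{\lambda_2}z_1^{\lambda_1-\lambda_2-j}$ for $\lambda_2>0$, $0\le j\le\lambda_1-\lambda_2$; $(1^2)=(1,1)$. $\mathfrak V_\beta$ is the variety of bicommutative algebras defined by the identity $\beta_1x(xy-yx)+\beta_2(xy-yx)x=0$, and $G_d(\mathfrak V_\beta)\cong F_d(\mathfrak V_\beta)$ is the factor algebra of $G_d$ modulo the T-ideal (ideal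 closed under all endomorphisms) generated by $(\beta_1y_1+\beta_2z_1)(y_1z_2-y_2z_1)$; elements of $G_d$ denote also their images. For a homogeneous $f$ of degree $n$ in $G_d(\mathfrak V_\beta)$, its consequences of degree $n+1$ are the elements of the degree $n+1$ homogeneous component of the T-ideal of $G_d(\mathfrak V_\beta)$ generated by $f$. They are "equivalent to" a list of polynomials if this component equals the $GL_d(K)$-submodule generated by the images of the polynomials in the list. *)

theory Defs
  imports
    "HOL-Library.Poly_Mapping"
    "HOL-Library.Product_Plus"
    "Jordan_Normal_Form.Matrix"
begin

section \<open>Nonassociative algebras, T-ideals and factor algebras\<close>

record ('k, 'a) nalg =
  Carr :: "'a set"
  Zero :: 'a
  Add :: "'a \<Rightarrow> 'a \<Rightarrow> 'a"
  Scal :: "'k \<Rightarrow> 'a \<Rightarrow> 'a"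
  Mult :: "'a \<Rightarrow> 'a \<Rightarrow> 'a"

definition is_subspace :: "('k, 'a) nalg \<Rightarrow> 'a set \<Rightarrow> bool" where
  "is_subspace A S \<longleftrightarrow> S \<subseteq> Carr A \<and> Zero A \<in> S \<and>
     (\<forall>s\<in>S. \<forall>t\<in>S. Add A s t \<in> S) \<and> (\<forall>c. \<forall>s\<in>S. Scal A c s \<in> S)"

definition is_ideal :: "('k, 'a) nalg \<Rightarrow> 'a set \<Rightarrow> bool" where
  "is_ideal A I \<longleftrightarrow> is_subspace A I \<and>
     (\<forall>a\<in>Carr A. \<forall>s\<in>I. Mult A a s \<in> I \<and> Mult A s a \<in> I)"

definition endos :: "('k, 'a) nalg \<Rightarrow> ('a \<Rightarrow> 'a) set" where
  "endos A = {\<phi>. (\<forall>a\<in>Carr A. \<phi> a \<in> Carr A) \<and>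
     (\<forall>a\<in>Carr A. \<forall>b\<in>Carr A. \<phi> (Add A a b) = Add A (\<phi> a) (\<phi> b)) \<and>
     (\<forall>c. \<forall>a\<in>Carr A. \<phi> (Scal A c a) = Scal A c (\<phi> a)) \<and>
     (\<forall>a\<in>Carr A. \<forall>b\<in>Carr A. \<phi> (Mult A a b) = Mult A (\<phi> a) (\<phi> b))}"

definition is_T_ideal :: "('k, 'a) nalg \<Rightarrow> 'a set \<Rightarrow> bool" where
  "is_T_ideal A I \<longleftrightarrow> is_ideal A I \<and> (\<forall>\<phi>\<in>endos A. \<phi> ` I \<subseteq> I)"

definition T_ideal :: "('k, 'a) nalg \<Rightarrow> 'a set \<Rightarrow> 'a set" where
  "T_ideal A S = \<Inter>{I. is_T_ideal A I \<and> S \<subseteq> I}"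

definition acoset :: "('k, 'a) nalg \<Rightarrow> 'a set \<Rightarrow> 'a \<Rightarrow> 'a set" where
  "acoset A I a = Add A a ` I"

text \<open>The operations are defined as unions over all representatives; for an ideal \<open>I\<close> every
  member of such a union is the same acoset.\<close>

definition factor_alg :: "('k, 'a) nalg \<Rightarrow> 'a set \<Rightarrow> ('k, 'a set) nalg" where
  "factor_alg A I = \<lparr>
     Carr = acoset A I ` Carr A,
     Zero = acoset A I (Zero A),
     Add = (\<lambda>P Q. \<Union>a\<in>P. \<Union>b\<in>Q. acoset A I (Add A a b)),
     Scal = (\<lambda>c P. \<Union>a\<in>P. acoset A I (Scal A c a)),
     Mult = (\<lambda>P Q. \<Union>a\<in>P. \<Union>b\<in>Q. acoset A I (Mult A a b)) \<rparr>"

definition factor_map :: "('k, 'a) nalg \<Rightarrow> 'a set \<Rightarrow> ('a \<Rightarrow> 'a) \<Rightarrow> 'a set \<Rightarrow> 'a set" where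
  "factor_map A I \<phi> P = (\<Union>a\<in>P. acoset A I (\<phi> a))"


section \<open>The polynomial algebra \<open>K[y\<^sub>1,y\<^sub>2,\<dots>,z\<^sub>1,z\<^sub>2,\<dots>]\<close>\<close>

text \<open>The key \<open>(a, b)\<close> stands for the monomial \<open>Y\<^sup>a Z\<^sup>b\<close>.\<close>

type_synonym 'k yzpoly = "((nat \<Rightarrow>\<^sub>0 nat) \<times> (nat \<Rightarrow>\<^sub>0 nat)) \<Rightarrow>\<^sub>0 'k"

definition yz_mono :: "(nat \<Rightarrow>\<^sub>0 nat) \<Rightarrow> (nat \<Rightarrow>\<^sub>0 nat) \<Rightarrow> 'k::field_char_0 yzpoly" where
  "yz_mono a b = Poly_Mapping.single (a, b) 1"

definition Const :: "'k::field_char_0 \<Rightarrow> 'k yzpoly" where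
  "Const c = Poly_Mapping.single 0 c"

definition py :: "nat \<Rightarrow> 'k::field_char_0 yzpoly" where
  "py i = yz_mono (Poly_Mapping.single i 1) 0"

definition pz :: "nat \<Rightarrow> 'k::field_char_0 yzpoly" where
  "pz i = yz_mono 0 (Poly_Mapping.single i 1)"

definition mdeg :: "(nat \<Rightarrow>\<^sub>0 nat) \<Rightarrow> nat" where
  "mdeg a = (\<Sum>i\<in>Poly_Mapping.keys a. Poly_Mapping.lookup a i)"

definition subst_yz ::
  "(nat \<Rightarrow> 'k::field_char_0 yzpoly) \<Rightarrow> (nat \<Rightarrow> 'k yzpoly) \<Rightarrow> 'k yzpoly \<Rightarrow> 'k yzpoly" where
  "subst_yz f g p = (\<Sum>(a, b)\<in>Poly_Mapping.keys p. Const (Poly_Mapping.lookup p (a, b)) *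
     ((\<Prod>i\<in>Poly_Mapping.keys a. f i ^ Poly_Mapping.lookup a i) *
      (\<Prod>i\<in>Poly_Mapping.keys b. g i ^ Poly_Mapping.lookup b i)))"


section \<open>The algebra \<open>G\<^sub>d\<close>\<close>

text \<open>A pair \<open>(v, p)\<close> stands for \<open>\<Sum>\<^sub>i v\<^sub>i x\<^sub>i + p\<close>.\<close>

type_synonym 'k gelem = "(nat \<Rightarrow>\<^sub>0 'k) \<times> 'k yzpoly"

definition gx :: "nat \<Rightarrow> 'k::field_char_0 gelem" where
  "gx i = (Poly_Mapping.single i 1, 0)"

definition pol :: "'k::field_char_0 yzpoly \<Rightarrow> 'k gelem" where
  "pol p = (0, p)"

definition gscale :: "'k::field_char_0 \<Rightarrow> 'k gelem \<Rightarrow> 'k gelem" (infixr \<open>*\<^sub>G\<close> 75) where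
  "c *\<^sub>G f = (Poly_Mapping.map ((*) c) (fst f), Const c * snd f)"

text \<open>The bilinear extension of \<open>x\<^sub>i x\<^sub>j = y\<^sub>i z\<^sub>j\<close>, \<open>x\<^sub>i m = y\<^sub>i m\<close>, \<open>m x\<^sub>j = m z\<^sub>j\<close> and of the
  multiplication of monomials; see \<open>gmult_basis\<close> at the end.\<close>

definition gmult :: "'k::field_char_0 gelem \<Rightarrow> 'k gelem \<Rightarrow> 'k gelem" where
  "gmult f g = (let v = fst f; p = snd f; w = fst g; q = snd g in
     pol ((\<Sum>i\<in>Poly_Mapping.keys v. \<Sum>j\<in>Poly_Mapping.keys w.
            Const (Poly_Mapping.lookup v i * Poly_Mapping.lookup w j) * (py i * pz j))
        + (\<Sum>i\<in>Poly_Mapping.keys v. Const (Poly_Mapping.lookup v i) * (py i * q))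
        + (\<Sum>j\<in>Poly_Mapping.keys w. Const (Poly_Mapping.lookup w j) * (p * pz j))
        + p * q))"

definition Gcarr :: "nat \<Rightarrow> 'k::field_char_0 gelem set" where
  "Gcarr d = {(v, p). Poly_Mapping.keys v \<subseteq> {1..d} \<and>
     (\<forall>(a, b)\<in>Poly_Mapping.keys p.
        Poly_Mapping.keys a \<subseteq> {1..d} \<and> Poly_Mapping.keys b \<subseteq> {1..d} \<and> 1 \<le> mdeg a \<and> 1 \<le> mdeg b)}"

definition G_alg :: "nat \<Rightarrow> ('k::field_char_0, 'k gelem) nalg" where
  "G_alg d = \<lparr> Carr = Gcarr d, Zero = 0, Add = (+), Scal = gscale, Mult = gmult \<rparr>"

definition Ghom :: "nat \<Rightarrow> nat \<Rightarrow> 'k::field_char_0 gelem set" where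
  "Ghom d n = {(v, p) \<in> Gcarr d. (n \<noteq> 1 \<longrightarrow> v = 0) \<and>
     (\<forall>(a, b)\<in>Poly_Mapping.keys p. mdeg a + mdeg b = n)}"

definition GL :: "nat \<Rightarrow> 'k::field_char_0 mat set" where
  "GL d = {g \<in> carrier_mat d d. invertible_mat g}"

text \<open>The automorphism of \<open>G\<^sub>d\<close> extending \<open>x\<^sub>i \<mapsto> \<Sum>\<^sub>j g\<^sub>j\<^sub>i x\<^sub>j\<close>; it transforms the \<open>y\<^sub>i\<close> and the \<open>z\<^sub>i\<close>
  in the same way. Matrix entries are indexed from \<open>0\<close>, variables from \<open>1\<close>.
  See \<open>gl_act_gx\<close> and \<open>gl_act_in_endos\<close> at the end.\<close>

definition gl_act :: "nat \<Rightarrow> 'k::field_char_0 mat \<Rightarrow> 'k gelem \<Rightarrow> 'k gelem" where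
  "gl_act d g f =
     ((\<Sum>i\<in>Poly_Mapping.keys (fst f). \<Sum>j\<in>{1..d}.
         Poly_Mapping.single j (g $$ (j - 1, i - 1) * Poly_Mapping.lookup (fst f) i)),
      subst_yz (\<lambda>i. \<Sum>j\<in>{1..d}. Const (g $$ (j - 1, i - 1)) * py j)
               (\<lambda>i. \<Sum>j\<in>{1..d}. Const (g $$ (j - 1, i - 1)) * pz j) (snd f))"


section \<open>The relatively free algebra \<open>G\<^sub>d(V\<^sub>\<beta>)\<close> and consequences in it\<close>

definition V_ideal :: "nat \<Rightarrow> 'k::field_char_0 \<times> 'k \<Rightarrow> 'k gelem set" where
  "V_ideal d \<beta> =
     T_ideal (G_alg d)
       {pol ((Const (fst \<beta>) * py 1 + Const (snd \<beta>) * pz 1) * (py 1 * pz 2 - py 2 * pz 1))}"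

definition GV :: "nat \<Rightarrow> 'k::field_char_0 \<times> 'k \<Rightarrow> ('k, 'k gelem set) nalg" where
  "GV d \<beta> = factor_alg (G_alg d) (V_ideal d \<beta>)"

definition img :: "nat \<Rightarrow> 'k::field_char_0 \<times> 'k \<Rightarrow> 'k gelem \<Rightarrow> 'k gelem set" where
  "img d \<beta> f = acoset (G_alg d) (V_ideal d \<beta>) f"

definition gl_act_V :: "nat \<Rightarrow> 'k::field_char_0 \<times> 'k \<Rightarrow> 'k mat \<Rightarrow> 'k gelem set \<Rightarrow> 'k gelem set" where
  "gl_act_V d \<beta> g = factor_map (G_alg d) (V_ideal d \<beta>) (gl_act d g)"

definition is_GL_submodule :: "nat \<Rightarrow> 'k::field_char_0 \<times> 'k \<Rightarrow> 'k gelem set set \<Rightarrow> bool" where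
  "is_GL_submodule d \<beta> M \<longleftrightarrow> is_subspace (GV d \<beta>) M \<and> (\<forall>g\<in>GL d. gl_act_V d \<beta> g ` M \<subseteq> M)"

definition GL_submodule :: "nat \<Rightarrow> 'k::field_char_0 \<times> 'k \<Rightarrow> 'k gelem set set \<Rightarrow> 'k gelem set set" where
  "GL_submodule d \<beta> S = \<Inter>{M. is_GL_submodule d \<beta> M \<and> S \<subseteq> M}"

definition consequences :: "nat \<Rightarrow> 'k::field_char_0 \<times> 'k \<Rightarrow> nat \<Rightarrow> 'k gelem \<Rightarrow> 'k gelem set set" where
  "consequences d \<beta> n f = T_ideal (GV d \<beta>) {img d \<beta> f} \<inter> img d \<beta> ` Ghom d (n + 1)"

definition conseq_equiv ::
  "nat \<Rightarrow> 'k::field_char_0 \<times> 'k \<Rightarrow> nat \<Rightarrow> 'k gelem \<Rightarrow> 'k gelem set \<Rightarrow> bool" where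
  "conseq_equiv d \<beta> n f L \<longleftrightarrow> consequences d \<beta> n f = GL_submodule d \<beta> (img d \<beta> ` L)"


section \<open>The polynomials \<open>w\<^sub>\<lambda>\<^sup>(\<^sup>j\<^sup>)\<close>\<close>

definition w_one :: "'k::field_char_0 gelem" where
  "w_one = gx 1"

definition w_row :: "nat \<Rightarrow> nat \<Rightarrow> 'k::field_char_0 gelem" where
  "w_row n j = pol (py 1 ^ j * pz 1 ^ (n - j))"

definition w_two :: "nat \<Rightarrow> nat \<Rightarrow> nat \<Rightarrow> 'k::field_char_0 gelem" where
  "w_two l1 l2 j = pol (py 1 ^ j * (py 1 * pz 2 - py 2 * pz 1) ^ l2 * pz 1 ^ (l1 - l2 - j))"



section \<open>\<open>G\<^sub>d\<close> is bicommutative and \<open>GL\<^sub>d(K)\<close> acts on it by endomorphisms\<close>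

lemma Const_mult: "Const (a * b) = Const a * Const b"
  by (simp add: Const_def mult_single)
lemma Const_add: "Const (a + b) = Const a + Const b"
  by (simp add: Const_def single_add)
lemma Const_0 [simp]: "Const 0 = 0"
  by (simp add: Const_def)
lemma Const_1 [simp]: "Const 1 = 1"
  by (simp add: Const_def)

definition lin :: "(nat \<Rightarrow>\<^sub>0 'k::field_char_0) \<Rightarrow> (nat \<Rightarrow> 'k yzpoly) \<Rightarrow> 'k yzpoly" where
  "lin v F = (\<Sum>i\<in>Poly_Mapping.keys v. Const (Poly_Mapping.lookup v i) * F i)"

lemma gmult_alt:
  "gmult (v, p) (w, q) = pol ((lin v py + p) * (lin w pz + q))"
proof -
  have "(\<Sum>i\<in>Poly_Mapping.keys v. \<Sum>j\<in>Poly_Mapping.keys w.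
      Const (Poly_Mapping.lookup v i * Poly_Mapping.lookup w j) * (py i * pz j)) = lin v py * lin w pz"
    by (simp add: lin_def sum_product Const_mult ac_simps)
  moreover have "(\<Sum>i\<in>Poly_Mapping.keys v. Const (Poly_Mapping.lookup v i) * (py i * q)) = lin v py * q"
    by (simp add: lin_def sum_distrib_right mult.assoc)
  moreover have "(\<Sum>j\<in>Poly_Mapping.keys w. Const (Poly_Mapping.lookup w j) * (p * pz j)) = p * lin w pz"
    by (simp add: lin_def sum_distrib_left ac_simps)
  ultimately have "gmult (v, p) (w, q) = pol (lin v py * lin w pz + lin v py * q + p * lin w pz + p * q)"
    by (simp add: gmult_def)
  also have "\<dots> = pol ((lin v py + p) * (lin w pz + q))"
    by (simp add: distrib_left distrib_right add.assoc add.left_commute)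
  finally show ?thesis .
qed

lemma gmult_basis:
  "gmult (gx i) (gx j) = pol (py i * pz j)"
  "gmult (gx i) (pol (yz_mono a b)) = pol (py i * yz_mono a b)"
  "gmult (pol (yz_mono a b)) (gx j) = pol (yz_mono a b * pz j)"
  "gmult (pol (yz_mono a b)) (pol (yz_mono a' b')) = pol (yz_mono (a + a') (b + b'))"
  by (simp_all add: gmult_alt gx_def pol_def lin_def yz_mono_def mult_single)

lemma gmult_right_comm: "gmult (gmult f g) h = gmult (gmult f h) g"
  by (cases f; cases g; cases h) (simp add: gmult_alt pol_def lin_def ac_simps)

lemma gmult_left_comm: "gmult f (gmult g h) = gmult g (gmult f h)"
  by (cases f; cases g; cases h) (simp add: gmult_alt pol_def lin_def ac_simps)

lemma lin_add: "lin (v + w) F = lin v F + lin w F"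
  unfolding lin_def
  by (rule setsum_keys_plus_distrib) (simp_all add: Const_add distrib_right)

definition evm :: "(nat \<Rightarrow> 'k::field_char_0 yzpoly) \<Rightarrow> (nat \<Rightarrow>\<^sub>0 nat) \<Rightarrow> 'k yzpoly" where
  "evm f a = (\<Prod>i\<in>Poly_Mapping.keys a. f i ^ Poly_Mapping.lookup a i)"

lemma evm_super: "finite S \<Longrightarrow> Poly_Mapping.keys a \<subseteq> S \<Longrightarrow> evm f a = (\<Prod>i\<in>S. f i ^ Poly_Mapping.lookup a i)"
  unfolding evm_def by (rule prod.mono_neutral_left) (auto simp: in_keys_iff)

lemma evm_add: "evm f (a + b) = evm f a * evm f b"
proof -
  let ?S = "Poly_Mapping.keys a \<union> Poly_Mapping.keys b"
  have "Poly_Mapping.keys (a + b) \<subseteq> ?S" by (rule Poly_Mapping.keys_add)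
  then show ?thesis
    by (simp add: evm_super[of ?S] lookup_add power_add prod.distrib)
qed

lemma subst_alt: "subst_yz f g p = (\<Sum>m\<in>Poly_Mapping.keys p. Const (Poly_Mapping.lookup p m) * (evm f (fst m) * evm g (snd m)))"
  by (simp add: subst_yz_def evm_def case_prod_unfold)

lemma subst_add: "subst_yz f g (p + q) = subst_yz f g p + subst_yz f g q"
  unfolding subst_alt
  by (rule setsum_keys_plus_distrib) (simp_all add: Const_add distrib_right)

lemma subst_0 [simp]: "subst_yz f g 0 = 0" by (simp add: subst_yz_def)

lemma subst_sum: "subst_yz f g (sum h S) = (\<Sum>s\<in>S. subst_yz f g (h s))"
  by (induct S rule: infinite_finite_induct) (simp_all add: subst_add)

lemma subst_single: "subst_yz f g (Poly_Mapping.single m c) = Const c * (evm f (fst m) * evm g (snd m))"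
  by (cases "c = 0") (simp_all add: subst_alt)

lemma pm_decomp: "p = (\<Sum>m\<in>Poly_Mapping.keys p. Poly_Mapping.single m (Poly_Mapping.lookup p m))"
  by (rule poly_mapping_eqI) (auto simp: lookup_sum lookup_single when_def in_keys_iff)

lemma subst_mult: "subst_yz f g (p * q) = subst_yz f g p * subst_yz f g q"
proof -
  have "p * q = (\<Sum>m\<in>Poly_Mapping.keys p. \<Sum>n\<in>Poly_Mapping.keys q.
     Poly_Mapping.single (m + n) (Poly_Mapping.lookup p m * Poly_Mapping.lookup q n))"
    by (subst (1) pm_decomp[of p], subst (1) pm_decomp[of q]) (simp add: sum_product mult_single)
  then have "subst_yz f g (p * q) = (\<Sum>m\<in>Poly_Mapping.keys p. \<Sum>n\<in>Poly_Mapping.keys q.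
      (Const (Poly_Mapping.lookup p m) * (evm f (fst m) * evm g (snd m))) *
      (Const (Poly_Mapping.lookup q n) * (evm f (fst n) * evm g (snd n))))"
    by (simp add: subst_sum subst_single evm_add Const_mult ac_simps)
  then show ?thesis by (simp add: subst_alt sum_product)
qed

lemma subst_Const [simp]: "subst_yz f g (Const c) = Const c"
  by (simp add: Const_def subst_single evm_def)
lemma subst_py [simp]: "subst_yz f g (py i) = f i"
  by (simp add: py_def yz_mono_def subst_single evm_def)
lemma subst_pz [simp]: "subst_yz f g (pz i) = g i"
  by (simp add: pz_def yz_mono_def subst_single evm_def)

lemma subst_lin: "subst_yz f g (lin v h) = lin v (\<lambda>i. subst_yz f g (h i))"
  by (simp add: lin_def subst_sum subst_mult)

lemma lin_0 [simp]: "lin 0 F = 0" by (simp add: lin_def)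
lemma lin_sum: "lin (sum h S) F = (\<Sum>s\<in>S. lin (h s) F)"
  by (induct S rule: infinite_finite_induct) (simp_all add: lin_add)
lemma lin_single: "lin (Poly_Mapping.single i c) F = Const c * F i"
  by (cases "c = 0") (simp_all add: lin_def)

definition gy where "gy d g i = (\<Sum>j\<in>{1..d}. Const (g $$ (j - 1, i - 1)) * py j)"
definition gz where "gz d g i = (\<Sum>j\<in>{1..d}. Const (g $$ (j - 1, i - 1)) * pz j)"
definition gv :: "nat \<Rightarrow> 'k::field_char_0 mat \<Rightarrow> (nat \<Rightarrow>\<^sub>0 'k) \<Rightarrow> (nat \<Rightarrow>\<^sub>0 'k)" where "gv d g v = (\<Sum>i\<in>Poly_Mapping.keys v. \<Sum>j\<in>{1..d}. Poly_Mapping.single j (g $$ (j - 1, i - 1) * Poly_Mapping.lookup v i))"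

lemma gl_act_alt: "gl_act d g (v, p) = (gv d g v, subst_yz (gy d g) (gz d g) p)"
  by (simp add: gl_act_def gv_def gy_def[abs_def] gz_def[abs_def])

lemma lin_gv: "lin (gv d g v) F = lin v (\<lambda>i. \<Sum>j\<in>{1..d}. Const (g $$ (j - 1, i - 1)) * F j)"
proof -
  have "lin (gv d g v) F = (\<Sum>i\<in>Poly_Mapping.keys v. \<Sum>j\<in>{1..d}.
      Const (g $$ (j - 1, i - 1) * Poly_Mapping.lookup v i) * F j)"
    unfolding gv_def by (simp only: lin_sum lin_single)
  then show ?thesis by (simp add: lin_def sum_distrib_left Const_mult ac_simps)
qed

lemma gl_mult: "gl_act d g (gmult f h) = gmult (gl_act d g f) (gl_act d g h)"
proof (cases f; cases h)
  fix v p w q assume "f = (v,p)" "h = (w,q)"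
  moreover have "lin (gv d g v) py = subst_yz (gy d g) (gz d g) (lin v py)"
    "lin (gv d g w) pz = subst_yz (gy d g) (gz d g) (lin w pz)"
    by (simp_all add: lin_gv subst_lin gy_def gz_def)
  ultimately show ?thesis
    by (simp add: gmult_alt pol_def gl_act_alt subst_mult subst_add) (simp add: gv_def)
qed

lemma gv_add: "gv d g (v + w) = gv d g v + gv d g w"
  unfolding gv_def
  by (rule setsum_keys_plus_distrib) (simp_all add: single_add distrib_left sum.distrib)

lemma gl_add: "gl_act d g (f + h) = gl_act d g f + gl_act d g h"
  by (cases f; cases h) (simp add: gl_act_alt gv_add subst_add)

lemma lookup_map_times: "Poly_Mapping.lookup (Poly_Mapping.map ((*) c) v) k = c * Poly_Mapping.lookup v k"
  for c :: "'k::field_char_0"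
  by (simp add: Poly_Mapping.map.rep_eq when_def)

lemma gv_scale: "gv d g (Poly_Mapping.map ((*) c) v) = Poly_Mapping.map ((*) c) (gv d g v)"
proof -
  have "gv d g (Poly_Mapping.map ((*) c) v) = (\<Sum>i\<in>Poly_Mapping.keys v. \<Sum>j\<in>{1..d}. Poly_Mapping.single j (g $$ (j - 1, i - 1) * (c * Poly_Mapping.lookup v i)))"
    unfolding gv_def
    by (rule sum.mono_neutral_cong_left) (auto simp: in_keys_iff lookup_map_times)
  also have "\<dots> = Poly_Mapping.map ((*) c) (gv d g v)"
    by (rule poly_mapping_eqI)
      (simp add: gv_def lookup_map_times lookup_sum lookup_single when_def sum_distrib_left ac_simps if_distrib cong: if_cong)
  finally show ?thesis .
qed

lemma gl_scale: "gl_act d g (gscale c f) = gscale c (gl_act d g f)"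
  by (cases f) (simp add: gscale_def gl_act_alt gv_scale subst_mult)

lemma gl_act_gx:
  "gl_act d g (gx i) = (\<Sum>j\<in>{1..d}. gscale (g $$ (j - 1, i - 1)) (gx j))"
  by (simp add: gx_def gl_act_alt gv_def gscale_def prod_eq_iff fst_sum snd_sum)

definition PB :: "nat \<Rightarrow> nat \<Rightarrow> nat \<Rightarrow> 'k::field_char_0 yzpoly set" where
  "PB d m n = {p. \<forall>(a,b)\<in>Poly_Mapping.keys p. Poly_Mapping.keys a \<subseteq> {1..d} \<and> Poly_Mapping.keys b \<subseteq> {1..d} \<and> mdeg a = m \<and> mdeg b = n}"

lemma mdeg_super: "finite S \<Longrightarrow> Poly_Mapping.keys a \<subseteq> S \<Longrightarrow> mdeg a = (\<Sum>i\<in>S. Poly_Mapping.lookup a i)"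
  unfolding mdeg_def by (rule sum.mono_neutral_left) (auto simp: in_keys_iff)
lemma mdeg_add: "mdeg (a + b) = mdeg a + mdeg b"
proof -
  let ?S = "Poly_Mapping.keys a \<union> Poly_Mapping.keys b"
  have "Poly_Mapping.keys (a + b) \<subseteq> ?S" by (rule Poly_Mapping.keys_add)
  then show ?thesis
    by (simp add: mdeg_super[of ?S] lookup_add sum.distrib)
qed

lemma PB_add: "p \<in> PB d m n \<Longrightarrow> q \<in> PB d m n \<Longrightarrow> p + q \<in> PB d m n"
  using Poly_Mapping.keys_add[of p q] by (fastforce simp: PB_def)
lemma PB_0: "0 \<in> PB d m n" by (simp add: PB_def)
lemma PB_sum: "(\<And>s. s \<in> S \<Longrightarrow> h s \<in> PB d m n) \<Longrightarrow> sum h S \<in> PB d m n"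
  by (induct S rule: infinite_finite_induct) (simp_all add: PB_add PB_0)
lemma PB_mult: assumes "p \<in> PB d m n" "q \<in> PB d m' n'" shows "p * q \<in> PB d (m+m') (n+n')"
proof -
  have "Poly_Mapping.keys a \<subseteq> {1..d} \<and> Poly_Mapping.keys b \<subseteq> {1..d} \<and> mdeg a = m+m' \<and> mdeg b = n+n'"
    if "(a,b) \<in> Poly_Mapping.keys (p*q)" for a b
  proof -
    from that obtain a1 b1 a2 b2 where *: "(a1,b1) \<in> Poly_Mapping.keys p" "(a2,b2) \<in> Poly_Mapping.keys q"
      and "a = a1 + a2" "b = b1 + b2" using Poly_Mapping.keys_mult[of p q] by force
    moreover have "Poly_Mapping.keys a1 \<subseteq> {1..d} \<and> Poly_Mapping.keys b1 \<subseteq> {1..d} \<and> mdeg a1 = m \<and> mdeg b1 = n"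
      "Poly_Mapping.keys a2 \<subseteq> {1..d} \<and> Poly_Mapping.keys b2 \<subseteq> {1..d} \<and> mdeg a2 = m' \<and> mdeg b2 = n'"
      using * assms unfolding PB_def by auto
    ultimately show ?thesis using Poly_Mapping.keys_add[of a1 a2] Poly_Mapping.keys_add[of b1 b2]
      by (fastforce simp: mdeg_add)
  qed
  then show ?thesis by (auto simp: PB_def)
qed
lemma PB_Const: "Const c \<in> PB d 0 0" by (auto simp: PB_def Const_def mdeg_def zero_prod_def)
lemma PB_py: "i \<in> {1..d} \<Longrightarrow> py i \<in> PB d 1 0" by (simp add: PB_def py_def yz_mono_def mdeg_def)
lemma PB_pz: "i \<in> {1..d} \<Longrightarrow> pz i \<in> PB d 0 1" by (simp add: PB_def pz_def yz_mono_def mdeg_def)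
lemma PB_gy: "gy d g i \<in> PB d 1 0" unfolding gy_def
  using PB_mult[OF PB_Const PB_py] by (intro PB_sum) simp
lemma PB_gz: "gz d g i \<in> PB d 0 1" unfolding gz_def
  using PB_mult[OF PB_Const PB_pz] by (intro PB_sum) simp
lemma PB_1: "1 \<in> PB d 0 0" using PB_Const[of 1] by simp
lemma PB_pow: "p \<in> PB d m n \<Longrightarrow> p ^ k \<in> PB d (k*m) (k*n)"
  by (induct k) (simp_all add: PB_1 PB_mult)
lemma PB_prod: "(\<And>s. s \<in> S \<Longrightarrow> h s \<in> PB d (m s) (n s)) \<Longrightarrow> prod h S \<in> PB d (sum m S) (sum n S)"
  by (induct S rule: infinite_finite_induct) (simp_all add: PB_mult PB_1)
lemma PB_evm_y: "evm (gy d g) a \<in> PB d (mdeg a) 0"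
  using PB_prod[of "Poly_Mapping.keys a", OF PB_pow[OF PB_gy]] by (simp add: evm_def mdeg_def)
lemma PB_evm_z: "evm (gz d g) a \<in> PB d 0 (mdeg a)"
  using PB_prod[of "Poly_Mapping.keys a", OF PB_pow[OF PB_gz]] by (simp add: evm_def mdeg_def)

lemma keys_sum_sub: "Poly_Mapping.keys (sum h S) \<subseteq> (\<Union>s\<in>S. Poly_Mapping.keys (h s))"
  by (rule Poly_Mapping.keys_sum)

lemma gl_carr: assumes "f \<in> Gcarr d" shows "gl_act d g f \<in> Gcarr d"
proof -
  obtain v p where f: "f = (v,p)" by force
  have "Poly_Mapping.keys (gv d g v) \<subseteq> {1..d}"
    unfolding gv_def by (intro order_trans[OF keys_sum_sub] UN_least) auto
  moreover have "Poly_Mapping.keys a \<subseteq> {1..d} \<and> Poly_Mapping.keys b \<subseteq> {1..d} \<and> 1 \<le> mdeg a \<and> 1 \<le> mdeg b"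
    if ab: "(a, b) \<in> Poly_Mapping.keys (subst_yz (gy d g) (gz d g) p)" for a b
  proof -
    from ab obtain m where m: "m \<in> Poly_Mapping.keys p"
      and k: "(a,b) \<in> Poly_Mapping.keys (Const (Poly_Mapping.lookup p m) * (evm (gy d g) (fst m) * evm (gz d g) (snd m)))"
      using subsetD[OF keys_sum_sub ab[unfolded subst_alt]] by (elim UN_E)
    have "Const (Poly_Mapping.lookup p m) * (evm (gy d g) (fst m) * evm (gz d g) (snd m)) \<in> PB d (mdeg (fst m)) (mdeg (snd m))"
      using PB_mult[OF PB_Const PB_mult[OF PB_evm_y PB_evm_z]] by simp
    with k have "Poly_Mapping.keys a \<subseteq> {1..d} \<and> Poly_Mapping.keys b \<subseteq> {1..d} \<and> mdeg a = mdeg (fst m) \<and> mdeg b = mdeg (snd m)"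
      unfolding PB_def by fast
    with m assms f show ?thesis by (fastforce simp: Gcarr_def)
  qed
  ultimately show ?thesis
    unfolding f gl_act_alt Gcarr_def mem_Collect_eq case_prod_conv by blast
qed

lemma gl_act_in_endos: "gl_act d g \<in> endos (G_alg d)"
  by (simp add: endos_def G_alg_def gl_carr gl_add gl_scale gl_mult)

end

theory Submission
  imports Defs "Jordan_Normal_Form.Gauss_Jordan_Elimination" "HOL-Computational_Algebra.Polynomial"
begin

text \<open>
  Put \<open>t\<^sub>i = y\<^sub>i - z\<^sub>i\<close> and \<open>[ij] = y\<^sub>i z\<^sub>j - y\<^sub>j z\<^sub>i\<close>. Since \<open>\<beta>\<^sub>2 = -\<beta>\<^sub>1\<close>, the defining identity is \<open>t\<^sub>1 [12]\<close>.
  Linearizing it gives all \<open>t\<^sub>k [ij]\<close>, because the cyclic sum of \<open>t\<^sub>k [ij]\<close> vanishes and \<open>3 \<noteq> 0\<close>;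
  substituting \<open>x\<^sub>a x\<^sub>b\<close> for \<open>x\<^sub>2\<close> gives all \<open>y\<^sub>a z\<^sub>b t\<^sub>i t\<^sub>j\<close>. Modulo these relations a monomial of degree
  \<open>m \<ge> 3\<close> depends only on its image in the free commutative algebra, up to elements
  \<open>Y z\<^sub>k t\<^sub>j\<close> with \<open>Y\<close> a monomial in the \<open>y\<^sub>i\<close>, and \<open>Y z\<^sub>k t\<^sub>j\<close> is symmetric in the letters of \<open>Y\<close> and \<open>k\<close>.
  A \<open>GL\<^sub>d\<close>-submodule is closed under the derivations \<open>x\<^sub>i \<mapsto> x\<^sub>j\<close>, so it contains all \<open>Y z\<^sub>k t\<^sub>j\<close>
  of degree \<open>m\<close>, that is, the kernel of the projection onto the commutative algebra, as soon as
  it contains \<open>y\<^sub>1\<^sup>m\<^sup>-\<^sup>2 z\<^sub>1 t\<^sub>1\<close> and \<open>y\<^sub>1\<^sup>m\<^sup>-\<^sup>2 [12]\<close>; together with \<open>y\<^sub>1\<^sup>m\<^sup>-\<^sup>1 z\<^sub>1\<close> these generate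
  the whole component. In (i)-(iii) the consequences are the whole component. In (iv) and (v)
  they are this kernel: the polynomial lies in the commutator ideal, which is a T-ideal of every
  algebra.
\<close>

section \<open>T-ideals and the commutator ideal\<close>

lemma is_idealI:
  assumes "I \<subseteq> Carr A" "Zero A \<in> I"
    and "\<And>s t. s \<in> I \<Longrightarrow> t \<in> I \<Longrightarrow> Add A s t \<in> I"
    and "\<And>c s. s \<in> I \<Longrightarrow> Scal A c s \<in> I"
    and "\<And>a s. a \<in> Carr A \<Longrightarrow> s \<in> I \<Longrightarrow> Mult A a s \<in> I"
    and "\<And>a s. a \<in> Carr A \<Longrightarrow> s \<in> I \<Longrightarrow> Mult A s a \<in> I"
  shows "is_ideal A I"
  using assms unfolding is_ideal_def is_subspace_def by simp

lemma is_idealD: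
  assumes "is_ideal A I"
  shows "I \<subseteq> Carr A" "Zero A \<in> I"
    and "\<And>s t. s \<in> I \<Longrightarrow> t \<in> I \<Longrightarrow> Add A s t \<in> I"
    and "\<And>c s. s \<in> I \<Longrightarrow> Scal A c s \<in> I"
    and "\<And>a s. a \<in> Carr A \<Longrightarrow> s \<in> I \<Longrightarrow> Mult A a s \<in> I"
    and "\<And>a s. a \<in> Carr A \<Longrightarrow> s \<in> I \<Longrightarrow> Mult A s a \<in> I"
  using assms unfolding is_ideal_def is_subspace_def by simp_all

lemma is_T_idealD:
  assumes "is_T_ideal A I"
  shows "is_ideal A I" "\<And>\<phi> s. \<phi> \<in> endos A \<Longrightarrow> s \<in> I \<Longrightarrow> \<phi> s \<in> I"
  using assms unfolding is_T_ideal_def by (simp_all add: image_subset_iff)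

lemma is_T_ideal_Carr: "is_ideal A (Carr A) \<Longrightarrow> is_T_ideal A (Carr A)"
  unfolding is_T_ideal_def endos_def by blast

lemma is_ideal_Inter:
  assumes "\<J> \<noteq> {}" and J: "\<And>I. I \<in> \<J> \<Longrightarrow> is_ideal A I"
  shows "is_ideal A (\<Inter>\<J>)"
proof (rule is_idealI)
  obtain I where "I \<in> \<J>" using assms(1) by blast
  then show "\<Inter>\<J> \<subseteq> Carr A" using is_idealD(1)[OF J] by (meson Inter_lower order_trans)
qed (simp_all add: is_idealD(2-6)[OF J])

text \<open>The carrier is itself a T-ideal containing \<open>S\<close>, so the intersection runs
  over a nonempty family and stays inside the carrier.\<close>

lemma is_T_ideal_T_ideal:
  assumes "is_ideal A (Carr A)" "S \<subseteq> Carr A"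
  shows "is_T_ideal A (T_ideal A S)"
  unfolding is_T_ideal_def
proof (intro conjI ballI)
  show "is_ideal A (T_ideal A S)"
    unfolding T_ideal_def using is_T_ideal_Carr[OF assms(1)] assms(2)
    by (intro is_ideal_Inter) (auto simp: is_T_ideal_def)
  fix \<phi> assume phi: "\<phi> \<in> endos A"
  show "\<phi> ` T_ideal A S \<subseteq> T_ideal A S"
    unfolding T_ideal_def using is_T_idealD(2)[OF _ phi] by blast
qed

lemma T_ideal_incl: "S \<subseteq> T_ideal A S"
  unfolding T_ideal_def by blast

lemma T_ideal_least: "is_T_ideal A I \<Longrightarrow> S \<subseteq> I \<Longrightarrow> T_ideal A S \<subseteq> I"
  unfolding T_ideal_def by blast

section \<open>The commutator ideal of an arbitrary algebra\<close>

definition commutators :: "('k::ring_1, 'a) nalg \<Rightarrow> 'a set" where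
  "commutators A = {Add A (Mult A a b) (Scal A (-1) (Mult A b a)) | a b. a \<in> Carr A \<and> b \<in> Carr A}"

definition commutator_ideal :: "('k::ring_1, 'a) nalg \<Rightarrow> 'a set" where
  "commutator_ideal A = \<Inter>{I. is_ideal A I \<and> commutators A \<subseteq> I}"

lemma commutators_sub_Carr: "is_ideal A (Carr A) \<Longrightarrow> commutators A \<subseteq> Carr A"
  unfolding commutators_def by (blast intro: is_idealD(3-5))

text \<open>The preimage of an ideal under an endomorphism is an ideal, and endomorphisms map
  commutators to commutators; hence no description of the endomorphisms is needed.\<close>

lemma is_T_ideal_commutator_ideal:
  assumes car: "is_ideal A (Carr A)" and zero: "\<And>a. a \<in> Carr A \<Longrightarrow> Scal A 0 a = Zero A"
  shows "is_T_ideal A (commutator_ideal A)"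
proof -
  have ideal: "is_ideal A (commutator_ideal A)"
    unfolding commutator_ideal_def using car commutators_sub_Carr[OF car]
    by (intro is_ideal_Inter) auto
  have "\<phi> s \<in> I" if phi: "\<phi> \<in> endos A" and s: "s \<in> commutator_ideal A"
    and I: "is_ideal A I" "commutators A \<subseteq> I" for \<phi> s I
  proof -
    note cl = is_idealD[OF car] and i = is_idealD[OF I(1)]
    have ph: "\<And>a. a \<in> Carr A \<Longrightarrow> \<phi> a \<in> Carr A"
      "\<And>a b. a \<in> Carr A \<Longrightarrow> b \<in> Carr A \<Longrightarrow> \<phi> (Add A a b) = Add A (\<phi> a) (\<phi> b)"
      "\<And>c a. a \<in> Carr A \<Longrightarrow> \<phi> (Scal A c a) = Scal A c (\<phi> a)"
      "\<And>a b. a \<in> Carr A \<Longrightarrow> b \<in> Carr A \<Longrightarrow> \<phi> (Mult A a b) = Mult A (\<phi> a) (\<phi> b)"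
      using phi unfolding endos_def by blast+
    let ?J = "{a \<in> Carr A. \<phi> a \<in> I}"
    \<comment> \<open>Membership in \<open>endos\<close> does not state this; it follows from
      \<open>Zero A = Scal A 0 (Zero A)\<close> and compatibility with scalars.\<close>
    have "\<phi> (Zero A) = Zero A"
      using ph(1,3)[of "Zero A"] zero cl(2) by metis
    then have "is_ideal A ?J"
      using cl(2-6) i(2-6) ph by (intro is_idealI) simp_all
    moreover have "commutators A \<subseteq> ?J"
    proof
      fix x assume "x \<in> commutators A"
      then obtain a b where ab: "a \<in> Carr A" "b \<in> Carr A"
        and x: "x = Add A (Mult A a b) (Scal A (-1) (Mult A b a))"
        unfolding commutators_def by blast
      have "\<phi> x = Add A (Mult A (\<phi> a) (\<phi> b)) (Scal A (-1) (Mult A (\<phi> b) (\<phi> a)))"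
        using ab cl ph unfolding x by simp
      then have "\<phi> x \<in> commutators A"
        using ab ph(1) unfolding commutators_def by blast
      then show "x \<in> ?J"
        using I(2) \<open>x \<in> commutators A\<close> commutators_sub_Carr[OF car] by blast
    qed
    ultimately have "s \<in> ?J"
      using s unfolding commutator_ideal_def by blast
    then show ?thesis by simp
  qed
  then have "\<phi> ` commutator_ideal A \<subseteq> commutator_ideal A" if "\<phi> \<in> endos A" for \<phi>
    using that by (subst (2) commutator_ideal_def) (simp add: image_subset_iff)
  then show ?thesis
    using ideal unfolding is_T_ideal_def by simp
qed

lemma commutators_in_ideal: "commutators A \<subseteq> commutator_ideal A"
  unfolding commutator_ideal_def by blast

lemma commutator_ideal_least: "is_ideal A I \<Longrightarrow> commutators A \<subseteq> I \<Longrightarrow> commutator_ideal A \<subseteq> I"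
  unfolding commutator_ideal_def by blast


section \<open>The algebra \<open>G\<^sub>d\<close>\<close>

lemma G_alg_simps [simp]:
  "Carr (G_alg d) = Gcarr d" "Zero (G_alg d) = 0" "Add (G_alg d) = (+)"
  "Scal (G_alg d) = gscale" "Mult (G_alg d) = gmult"
  by (simp_all add: G_alg_def)

section \<open>Supports of elements of the algebra and closure under its operations\<close>

definition exps :: "nat \<Rightarrow> ((nat \<Rightarrow>\<^sub>0 nat) \<times> (nat \<Rightarrow>\<^sub>0 nat)) set" where
  "exps d = {(a, b). Poly_Mapping.keys a \<subseteq> {1..d} \<and> Poly_Mapping.keys b \<subseteq> {1..d} \<and> 1 \<le> mdeg a \<and> 1 \<le> mdeg b}"

lemma Gcarr_iff: "f \<in> Gcarr d \<longleftrightarrow> Poly_Mapping.keys (fst f) \<subseteq> {1..d} \<and> Poly_Mapping.keys (snd f) \<subseteq> exps d"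
  by (cases f) (auto simp: Gcarr_def exps_def)

lemma Ghom_iff:
  "f \<in> Ghom d n \<longleftrightarrow> f \<in> Gcarr d \<and> (n \<noteq> 1 \<longrightarrow> fst f = 0) \<and>
    Poly_Mapping.keys (snd f) \<subseteq> {m. mdeg (fst m) + mdeg (snd m) = n}"
  by (cases f) (auto simp: Ghom_def)

lemma mdeg_0 [simp]: "mdeg 0 = 0"
  by (simp add: mdeg_def)

lemma mdeg_single [simp]: "mdeg (Poly_Mapping.single i k) = k"
  by (simp add: mdeg_def)

lemma keys_add_nat: "Poly_Mapping.keys (a + b) = Poly_Mapping.keys a \<union> Poly_Mapping.keys b"
  for a b :: "nat \<Rightarrow>\<^sub>0 nat"
  by (auto simp: in_keys_iff lookup_add)

lemma lookup_Const_mult: "Poly_Mapping.lookup (Const c * p) m = c * Poly_Mapping.lookup p m"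
proof -
  have "Const c * p = (\<Sum>n\<in>Poly_Mapping.keys p. Poly_Mapping.single n (c * Poly_Mapping.lookup p n))"
    by (subst pm_decomp[of p]) (simp add: sum_distrib_left Const_def mult_single)
  then show ?thesis
    by (auto simp: lookup_sum lookup_single when_def in_keys_iff)
qed

lemma keys_Const_mult: "Poly_Mapping.keys (Const c * p) \<subseteq> Poly_Mapping.keys p"
  by (auto simp: in_keys_iff lookup_Const_mult)

lemma keys_subset_add:
  "Poly_Mapping.keys p \<subseteq> S \<Longrightarrow> Poly_Mapping.keys q \<subseteq> S \<Longrightarrow> Poly_Mapping.keys (p + q) \<subseteq> S"
  using Poly_Mapping.keys_add[of p q] by blast

lemma keys_subset_Const_mult:
  "Poly_Mapping.keys p \<subseteq> S \<Longrightarrow> Poly_Mapping.keys (Const c * p) \<subseteq> S"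
  using keys_Const_mult[of c p] by blast

lemma keys_subset_sum:
  "(\<And>s. s \<in> A \<Longrightarrow> Poly_Mapping.keys (h s) \<subseteq> S) \<Longrightarrow> Poly_Mapping.keys (sum h A) \<subseteq> S"
  using keys_sum_sub[of h A] by blast

lemma keys_subset_mult:
  assumes "Poly_Mapping.keys p \<subseteq> S" "Poly_Mapping.keys q \<subseteq> T"
    and "\<And>m n. m \<in> S \<Longrightarrow> n \<in> T \<Longrightarrow> m + n \<in> U"
  shows "Poly_Mapping.keys (p * q) \<subseteq> U"
  using Poly_Mapping.keys_mult[of p q] assms by blast

lemma Gcarr_0: "0 \<in> Gcarr d"
  by (simp add: Gcarr_iff)

lemma Gcarr_add: "f \<in> Gcarr d \<Longrightarrow> g \<in> Gcarr d \<Longrightarrow> f + g \<in> Gcarr d"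
  by (simp add: Gcarr_iff keys_subset_add)

lemma Gcarr_scale: "f \<in> Gcarr d \<Longrightarrow> gscale c f \<in> Gcarr d"
  by (auto simp: Gcarr_iff gscale_def in_keys_iff lookup_map_times lookup_Const_mult)

text \<open>As a left factor an element enters a product with x_i read as y_i, as a right factor
  with x_i read as z_i. This turns the multiplication into one polynomial product, see
  \<open>gmult_gYZ\<close>.\<close>

definition gY :: "'k::field_char_0 gelem \<Rightarrow> 'k yzpoly" where "gY f = lin (fst f) py + snd f"
definition gZ :: "'k::field_char_0 gelem \<Rightarrow> 'k yzpoly" where "gZ f = lin (fst f) pz + snd f"

lemma gmult_gYZ: "gmult f g = pol (gY f * gZ g)"
  by (cases f; cases g) (simp add: gmult_alt gY_def gZ_def)

lemma gY_pol [simp]: "gY (pol p) = p" and gZ_pol [simp]: "gZ (pol p) = p"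
  by (simp_all add: gY_def gZ_def pol_def)

lemma gY_gx [simp]: "gY (gx i) = py i" and gZ_gx [simp]: "gZ (gx i) = pz i"
  by (simp_all add: gY_def gZ_def gx_def lin_single)

lemma gY_add [simp]: "gY (f + g) = gY f + gY g" and gZ_add [simp]: "gZ (f + g) = gZ f + gZ g"
  by (simp_all add: gY_def gZ_def lin_add algebra_simps)

lemma lin_scale: "lin (Poly_Mapping.map ((*) c) v) F = Const c * lin v F"
proof -
  have "lin (Poly_Mapping.map ((*) c) v) F = (\<Sum>i\<in>Poly_Mapping.keys v. Const (c * Poly_Mapping.lookup v i) * F i)"
    unfolding lin_def by (rule sum.mono_neutral_cong_left) (auto simp: in_keys_iff lookup_map_times)
  then show ?thesis
    by (simp add: lin_def sum_distrib_left Const_mult ac_simps)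
qed

lemma gY_scale [simp]: "gY (gscale c f) = Const c * gY f" and gZ_scale [simp]: "gZ (gscale c f) = Const c * gZ f"
  by (simp_all add: gY_def gZ_def gscale_def lin_scale algebra_simps)

lemma gY_sum: "gY (sum h S) = (\<Sum>s\<in>S. gY (h s))" and gZ_sum: "gZ (sum h S) = (\<Sum>s\<in>S. gZ (h s))"
  by (induct S rule: infinite_finite_induct) (simp_all add: gY_def gZ_def lin_add algebra_simps)

text \<open>\<open>yexps\<close> and \<open>zexps\<close> bound the supports of left and right
  factors: the left one contributes some y, the right one some z, so a product has both.\<close>

definition yexps :: "nat \<Rightarrow> ((nat \<Rightarrow>\<^sub>0 nat) \<times> (nat \<Rightarrow>\<^sub>0 nat)) set" where
  "yexps d = {(a, b). Poly_Mapping.keys a \<subseteq> {1..d} \<and> Poly_Mapping.keys b \<subseteq> {1..d} \<and> 1 \<le> mdeg a}"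
definition zexps :: "nat \<Rightarrow> ((nat \<Rightarrow>\<^sub>0 nat) \<times> (nat \<Rightarrow>\<^sub>0 nat)) set" where
  "zexps d = {(a, b). Poly_Mapping.keys a \<subseteq> {1..d} \<and> Poly_Mapping.keys b \<subseteq> {1..d} \<and> 1 \<le> mdeg b}"

lemma keys_gY:
  assumes "f \<in> Gcarr d" shows "Poly_Mapping.keys (gY f) \<subseteq> yexps d"
proof -
  have "Poly_Mapping.keys (lin (fst f) py) \<subseteq> yexps d"
    using assms unfolding lin_def Gcarr_iff
    by (intro keys_subset_sum keys_subset_Const_mult) (auto simp: py_def yz_mono_def yexps_def)
  then show ?thesis
    using assms unfolding gY_def Gcarr_iff by (intro keys_subset_add) (auto simp: yexps_def exps_def)
qed

lemma keys_gZ: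
  assumes "f \<in> Gcarr d" shows "Poly_Mapping.keys (gZ f) \<subseteq> zexps d"
proof -
  have "Poly_Mapping.keys (lin (fst f) pz) \<subseteq> zexps d"
    using assms unfolding lin_def Gcarr_iff
    by (intro keys_subset_sum keys_subset_Const_mult) (auto simp: pz_def yz_mono_def zexps_def)
  then show ?thesis
    using assms unfolding gZ_def Gcarr_iff by (intro keys_subset_add) (auto simp: zexps_def exps_def)
qed

lemma yexps_zexps_add: "m \<in> yexps d \<Longrightarrow> n \<in> zexps d \<Longrightarrow> m + n \<in> exps d"
  by (cases m; cases n) (simp add: yexps_def zexps_def exps_def mdeg_add keys_add_nat)

lemma Gcarr_mult: "f \<in> Gcarr d \<Longrightarrow> g \<in> Gcarr d \<Longrightarrow> gmult f g \<in> Gcarr d"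
  using keys_subset_mult[OF keys_gY keys_gZ yexps_zexps_add, of f d g]
  by (simp add: Gcarr_iff gmult_gYZ pol_def)

lemma is_ideal_Gcarr: "is_ideal (G_alg d) (Gcarr d)"
  by (rule is_idealI) (simp_all add: Gcarr_0 Gcarr_add Gcarr_scale Gcarr_mult)

lemma gscale_0 [simp]: "gscale 0 f = 0"
  by (auto simp: gscale_def prod_eq_iff intro: poly_mapping_eqI simp: lookup_map_times)

lemma gscale_minus: "gscale (-1) f = - f"
  by (auto simp: gscale_def prod_eq_iff lookup_map_times lookup_Const_mult intro!: poly_mapping_eqI)

lemma gscale_pol [simp]: "gscale c (pol p) = pol (Const c * p)"
  by (auto simp: gscale_def pol_def intro: poly_mapping_eqI simp: lookup_map_times)

lemma pol_add: "pol p + pol q = pol (p + q)" and pol_diff: "pol p - pol q = pol (p - q)"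
  by (simp_all add: pol_def)

lemma gx_in_Gcarr: "i \<in> {1..d} \<Longrightarrow> gx i \<in> Gcarr d"
  by (simp add: Gcarr_iff gx_def)

lemma py_pz_in_Gcarr: "i \<in> {1..d} \<Longrightarrow> j \<in> {1..d} \<Longrightarrow> pol (py i * pz j) \<in> Gcarr d"
  using Gcarr_mult[OF gx_in_Gcarr gx_in_Gcarr, of i d j] by (simp add: gmult_gYZ)

text \<open>The endomorphism \<open>x\<^sub>i \<mapsto> u\<^sub>i\<close>.\<close>

definition gsub :: "(nat \<Rightarrow> 'k::field_char_0 gelem) \<Rightarrow> 'k gelem \<Rightarrow> 'k gelem" where
  "gsub u f = (\<Sum>i\<in>Poly_Mapping.keys (fst f). gscale (Poly_Mapping.lookup (fst f) i) (u i)) +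
     pol (subst_yz (\<lambda>i. gY (u i)) (\<lambda>i. gZ (u i)) (snd f))"

lemma gscale_add_left: "gscale (a + b) f = gscale a f + gscale b f"
  by (auto simp: gscale_def prod_eq_iff lookup_map_times lookup_Const_mult lookup_add
      distrib_right intro!: poly_mapping_eqI)

lemma gscale_add_right: "gscale a (f + g) = gscale a f + gscale a g"
  by (auto simp: gscale_def prod_eq_iff lookup_map_times lookup_Const_mult lookup_add
      distrib_left intro!: poly_mapping_eqI)

lemma gscale_mult: "gscale (a * b) f = gscale a (gscale b f)"
  by (auto simp: gscale_def prod_eq_iff lookup_map_times lookup_Const_mult mult.assoc intro!: poly_mapping_eqI)

lemma gscale_0_right [simp]: "gscale a 0 = 0"
  by (auto simp: gscale_def prod_eq_iff lookup_map_times intro!: poly_mapping_eqI)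

lemma gscale_sum: "gscale a (sum h S) = (\<Sum>s\<in>S. gscale a (h s))"
  by (induct S rule: infinite_finite_induct) (simp_all add: gscale_add_right)

lemma gsub_add: "gsub u (f + g) = gsub u f + gsub u g"
proof -
  have "(\<Sum>i\<in>Poly_Mapping.keys (fst f + fst g). gscale (Poly_Mapping.lookup (fst f + fst g) i) (u i)) =
    (\<Sum>i\<in>Poly_Mapping.keys (fst f). gscale (Poly_Mapping.lookup (fst f) i) (u i)) +
    (\<Sum>i\<in>Poly_Mapping.keys (fst g). gscale (Poly_Mapping.lookup (fst g) i) (u i))"
    by (rule setsum_keys_plus_distrib) (simp_all add: gscale_add_left)
  then show ?thesis
    by (simp add: gsub_def subst_add pol_add[symmetric])
qed

lemma gsub_scale: "gsub u (gscale c f) = gscale c (gsub u f)"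
proof -
  have "(\<Sum>i\<in>Poly_Mapping.keys (fst (gscale c f)). gscale (Poly_Mapping.lookup (fst (gscale c f)) i) (u i)) =
    (\<Sum>i\<in>Poly_Mapping.keys (fst f). gscale (c * Poly_Mapping.lookup (fst f) i) (u i))"
    by (rule sum.mono_neutral_cong_left) (auto simp: in_keys_iff lookup_map_times gscale_def[of c])
  also have "\<dots> = gscale c (\<Sum>i\<in>Poly_Mapping.keys (fst f). gscale (Poly_Mapping.lookup (fst f) i) (u i))"
    by (simp add: gscale_mult gscale_sum)
  finally show ?thesis
    by (simp add: gsub_def gscale_add_right) (simp add: gscale_def[of c f] subst_mult)
qed

lemma gsub_pol: "gsub u (pol p) = pol (subst_yz (\<lambda>i. gY (u i)) (\<lambda>i. gZ (u i)) p)"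
  by (simp add: gsub_def pol_def)

text \<open>\<open>gY\<close> and \<open>gZ\<close> intertwine \<open>gsub u\<close> with one and
  the same polynomial substitution, which is multiplicative.\<close>

lemma gsub_mult: "gsub u (gmult f g) = gmult (gsub u f) (gsub u g)"
proof -
  have "gY (gsub u f) = subst_yz (\<lambda>i. gY (u i)) (\<lambda>i. gZ (u i)) (gY f)" for f
    by (simp add: gsub_def gY_sum) (simp add: gY_def[of f] subst_add subst_lin, simp add: lin_def)
  moreover have "gZ (gsub u f) = subst_yz (\<lambda>i. gY (u i)) (\<lambda>i. gZ (u i)) (gZ f)" for f
    by (simp add: gsub_def gZ_sum) (simp add: gZ_def[of f] subst_add subst_lin, simp add: lin_def)
  ultimately show ?thesis
    by (simp add: gmult_gYZ gsub_pol subst_mult)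
qed

section \<open>Induction over monomials and supports of substituted polynomials\<close>

lemma exponent_split:
  assumes "i \<in> Poly_Mapping.keys (a :: nat \<Rightarrow>\<^sub>0 nat)"
  obtains b where "a = b + Poly_Mapping.single i 1"
proof
  show "a = (a - Poly_Mapping.single i 1) + Poly_Mapping.single i 1"
    using assms
    by (auto simp: lookup_add lookup_minus lookup_single when_def in_keys_iff intro!: poly_mapping_eqI)
qed

lemma exponent_induct [case_names zero add]:
  assumes "P 0" and "\<And>a i. P a \<Longrightarrow> P (a + Poly_Mapping.single i 1)"
  shows "P (a :: nat \<Rightarrow>\<^sub>0 nat)"
proof (induct "mdeg a" arbitrary: a rule: less_induct)
  case less
  show ?case
  proof (cases "a = 0")
    case False
    then obtain i where "i \<in> Poly_Mapping.keys a" by fastforce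
    then obtain b where b: "a = b + Poly_Mapping.single i 1" by (rule exponent_split)
    then show ?thesis using less[of b] assms(2) by (simp add: mdeg_add)
  qed (simp add: assms(1))
qed

lemma evm_0 [simp]: "evm F 0 = 1"
  by (simp add: evm_def)

lemma evm_single [simp]: "evm F (Poly_Mapping.single i 1) = F i"
  by (simp add: evm_def)

lemma keys_evm:
  assumes add: "\<And>m n. m \<in> S \<Longrightarrow> n \<in> S \<Longrightarrow> m + n \<in> S"
    and F: "\<And>i. i \<in> Poly_Mapping.keys a \<Longrightarrow> Poly_Mapping.keys (F i) \<subseteq> S" and a: "1 \<le> mdeg a"
  shows "Poly_Mapping.keys (evm F a) \<subseteq> S"
proof -
  \<comment> \<open>\<open>S\<close> need not contain 0, so the empty monomial is tracked separately
    during the induction.\<close>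
  have "Poly_Mapping.keys (evm F a) \<subseteq> (if mdeg a = 0 then {0} else S)"
    using F
  proof (induct a rule: exponent_induct)
    case (add a i)
    then have "Poly_Mapping.keys (evm F a) \<subseteq> insert 0 S" "Poly_Mapping.keys (F i) \<subseteq> S"
      by (auto simp: keys_add_nat split: if_splits)
    then have "Poly_Mapping.keys (evm F a * F i) \<subseteq> S"
      by (rule keys_subset_mult) (auto intro: assms(1))
    then show ?case by (simp only: evm_add evm_single mdeg_add) simp
  qed simp
  with a show ?thesis by simp
qed

lemma keys_subst_gYZ:
  assumes u: "\<And>i. i \<in> {1..d} \<Longrightarrow> u i \<in> Gcarr d" and p: "Poly_Mapping.keys p \<subseteq> exps d"
  shows "Poly_Mapping.keys (subst_yz (\<lambda>i. gY (u i)) (\<lambda>i. gZ (u i)) p) \<subseteq> exps d"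
  unfolding subst_alt
proof (intro keys_subset_sum keys_subset_Const_mult)
  fix m assume "m \<in> Poly_Mapping.keys p"
  then have "m \<in> exps d" using p by blast
  then have m: "Poly_Mapping.keys (fst m) \<subseteq> {1..d}" "Poly_Mapping.keys (snd m) \<subseteq> {1..d}"
    "1 \<le> mdeg (fst m)" "1 \<le> mdeg (snd m)"
    by (cases m; simp add: exps_def)+
  have "Poly_Mapping.keys (evm (\<lambda>i. gY (u i)) (fst m)) \<subseteq> yexps d"
    using m(1) by (intro keys_evm keys_gY u m(3)) (auto simp: yexps_def mdeg_add keys_add_nat subset_iff)
  moreover have "Poly_Mapping.keys (evm (\<lambda>i. gZ (u i)) (snd m)) \<subseteq> zexps d"
    using m(2) by (intro keys_evm keys_gZ u m(4)) (auto simp: zexps_def mdeg_add keys_add_nat subset_iff)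
  ultimately show "Poly_Mapping.keys (evm (\<lambda>i. gY (u i)) (fst m) * evm (\<lambda>i. gZ (u i)) (snd m)) \<subseteq> exps d"
    by (rule keys_subset_mult[OF _ _ yexps_zexps_add])
qed

lemma Gcarr_sum: "(\<And>s. s \<in> S \<Longrightarrow> h s \<in> Gcarr d) \<Longrightarrow> sum h S \<in> Gcarr d"
  by (induct S rule: infinite_finite_induct) (simp_all add: Gcarr_0 Gcarr_add)

lemma gsub_in_endos:
  assumes u: "\<And>i. i \<in> {1..d} \<Longrightarrow> u i \<in> Gcarr d"
  shows "gsub u \<in> endos (G_alg d)"
proof -
  have "gsub u f \<in> Gcarr d" if "f \<in> Gcarr d" for f
    unfolding gsub_def
  proof (rule Gcarr_add)
    show "(\<Sum>i\<in>Poly_Mapping.keys (fst f). gscale (Poly_Mapping.lookup (fst f) i) (u i)) \<in> Gcarr d"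
      using that by (intro Gcarr_sum Gcarr_scale u) (auto simp: Gcarr_iff)
    show "pol (subst_yz (\<lambda>i. gY (u i)) (\<lambda>i. gZ (u i)) (snd f)) \<in> Gcarr d"
      using keys_subst_gYZ[of d u "snd f"] u that by (simp add: Gcarr_iff pol_def)
  qed
  then show ?thesis
    by (simp add: endos_def gsub_add gsub_scale gsub_mult)
qed

section \<open>Factor algebras of \<open>G\<^sub>d\<close>\<close>

text \<open>Evaluates the unions over representatives in \<open>factor_alg\<close> once all
  representatives are known to give the same coset.\<close>

lemma UN_const_eq: "a \<in> A \<Longrightarrow> (\<And>x. x \<in> A \<Longrightarrow> h x = B) \<Longrightarrow> (\<Union>x\<in>A. h x) = B"
  by blast

lemma gscale_diff: "gscale c (x - a) = gscale c x - gscale c a"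
  using gscale_add_right[of c "x - a" a] by simp

lemma gY_diff: "gY (x - a) = gY x - gY a" and gZ_diff: "gZ (x - a) = gZ x - gZ a"
  using gY_add[of "x - a" a] gZ_add[of "x - a" a] by simp_all

lemma endo_diff:
  assumes "\<phi> \<in> endos (G_alg d)" "x \<in> Gcarr d" "y \<in> Gcarr d"
  shows "\<phi> (x - y) = \<phi> x - \<phi> y"
proof -
  have "\<phi> (x + gscale (-1) y) = \<phi> x + gscale (-1) (\<phi> y)"
    using assms Gcarr_scale[OF assms(3), of "-1"] by (simp add: endos_def)
  then show ?thesis by (simp add: gscale_minus)
qed

text \<open>A T-ideal rather than an ideal, so that endomorphisms of \<open>G_alg d\<close>, among
  them the action of the linear group, descend to the factor algebra.\<close>

locale T_factor =
  fixes d :: nat and I :: "'k::field_char_0 gelem set"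
  assumes T_ideal: "is_T_ideal (G_alg d) I"
begin

abbreviation "F \<equiv> factor_alg (G_alg d) I"
abbreviation "cs \<equiv> acoset (G_alg d) I"

lemmas ideal = is_T_idealD(1)[OF T_ideal]
lemmas I_sub = is_idealD(1)[OF ideal, unfolded G_alg_simps]
lemmas I_0 = is_idealD(2)[OF ideal, unfolded G_alg_simps]
lemmas I_add = is_idealD(3)[OF ideal, unfolded G_alg_simps]
lemmas I_scale = is_idealD(4)[OF ideal, unfolded G_alg_simps]
lemmas I_mult = is_idealD(5,6)[OF ideal, unfolded G_alg_simps]

lemma I_minus: "a \<in> I \<Longrightarrow> - a \<in> I"
  using I_scale[of a "-1"] by (simp add: gscale_minus)

lemma I_diff: "a \<in> I \<Longrightarrow> b \<in> I \<Longrightarrow> a - b \<in> I"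
  using I_add[OF _ I_minus] by fastforce

lemma mem_coset: "x \<in> cs a \<longleftrightarrow> x - a \<in> I"
  by (force simp: acoset_def image_iff)

lemma coset_eq_iff: "cs a = cs b \<longleftrightarrow> a - b \<in> I"
proof
  assume "cs a = cs b"
  then show "a - b \<in> I" using mem_coset[of a b] mem_coset[of a a] I_0 by simp
next
  assume ab: "a - b \<in> I"
  have "x - a \<in> I \<longleftrightarrow> x - b \<in> I" for x
    using I_add[OF _ ab, of "x - a"] I_diff[OF _ ab, of "x - b"] by (auto simp: algebra_simps)
  then show "cs a = cs b" by (auto simp: mem_coset)
qed

lemma self_in_coset: "a \<in> cs a"
  by (simp add: mem_coset I_0)

lemma coset_sub_Gcarr: "a \<in> Gcarr d \<Longrightarrow> cs a \<subseteq> Gcarr d"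
proof
  fix x assume "a \<in> Gcarr d" "x \<in> cs a"
  then show "x \<in> Gcarr d"
    using Gcarr_add[of a d "x - a"] subsetD[OF I_sub, of "x - a"] by (simp add: mem_coset)
qed

lemma factor_simps:
  "Carr F = cs ` Gcarr d" "Zero F = cs 0"
  by (simp_all add: factor_alg_def)

lemma factor_Add: "Add F (cs a) (cs b) = cs (a + b)"
proof -
  have "cs (x + y) = cs (a + b)" if "x \<in> cs a" "y \<in> cs b" for x y
    using I_add[of "x - a" "y - b"] that by (simp add: coset_eq_iff mem_coset algebra_simps)
  then have "(\<Union>x\<in>cs a. \<Union>y\<in>cs b. cs (x + y)) = cs (a + b)"
    by (intro UN_const_eq[OF self_in_coset] UN_const_eq[OF self_in_coset])
  then show ?thesis by (simp add: factor_alg_def)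
qed

lemma factor_Scal: "Scal F c (cs a) = cs (gscale c a)"
proof -
  have "cs (gscale c x) = cs (gscale c a)" if "x \<in> cs a" for x
    using I_scale[of "x - a" c] that by (simp add: coset_eq_iff mem_coset gscale_diff)
  then have "(\<Union>x\<in>cs a. cs (gscale c x)) = cs (gscale c a)"
    by (intro UN_const_eq[OF self_in_coset])
  then show ?thesis by (simp add: factor_alg_def)
qed

lemma factor_Mult:
  assumes "a \<in> Gcarr d" "b \<in> Gcarr d"
  shows "Mult F (cs a) (cs b) = cs (gmult a b)"
proof -
  have "cs (gmult x y) = cs (gmult a b)" if x: "x \<in> cs a" and y: "y \<in> cs b" for x y
  proof -
    have "gmult x y - gmult a b = gmult (x - a) y + gmult a (y - b)"
      by (simp add: gmult_gYZ pol_add pol_diff gY_diff gZ_diff algebra_simps)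
    moreover have "y \<in> Gcarr d"
      using y assms(2) coset_sub_Gcarr by blast
    then have "gmult (x - a) y \<in> I" "gmult a (y - b) \<in> I"
      using x y assms(1) I_mult(1)[of a "y - b"] I_mult(2)[of y "x - a"] by (simp_all add: mem_coset)
    ultimately show ?thesis by (simp add: coset_eq_iff I_add)
  qed
  then have "(\<Union>x\<in>cs a. \<Union>y\<in>cs b. cs (gmult x y)) = cs (gmult a b)"
    by (intro UN_const_eq[OF self_in_coset] UN_const_eq[OF self_in_coset])
  then show ?thesis by (simp add: factor_alg_def)
qed

lemma factor_map_coset:
  assumes phi: "\<phi> \<in> endos (G_alg d)" and a: "a \<in> Gcarr d"
  shows "factor_map (G_alg d) I \<phi> (cs a) = cs (\<phi> a)"
proof -
  have "cs (\<phi> x) = cs (\<phi> a)" if "x \<in> cs a" for x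
    using is_T_idealD(2)[OF T_ideal phi, of "x - a"] that endo_diff[OF phi _ a, of x] coset_sub_Gcarr[OF a]
    by (auto simp: coset_eq_iff mem_coset)
  then show ?thesis
    unfolding factor_map_def by (intro UN_const_eq[OF self_in_coset])
qed

lemma factor_map_in_endos:
  assumes phi: "\<phi> \<in> endos (G_alg d)"
  shows "factor_map (G_alg d) I \<phi> \<in> endos F"
  using phi unfolding endos_def
  by (auto simp: factor_simps factor_Add factor_Scal factor_Mult factor_map_coset[OF phi]
      Gcarr_add Gcarr_scale Gcarr_mult)

lemma is_ideal_factor: "is_ideal F (Carr F)"
  unfolding factor_simps
  by (rule is_idealI; (unfold factor_simps)?; (elim imageE)?;
    simp add: factor_simps factor_Add factor_Scal factor_Mult Gcarr_0 Gcarr_add Gcarr_scale Gcarr_mult)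

lemma pullback_subspace:
  assumes "is_subspace F J"
  shows "is_subspace (G_alg d) {a \<in> Gcarr d. cs a \<in> J}"
  using assms by (auto simp: is_subspace_def Gcarr_0 Gcarr_add Gcarr_scale
      factor_simps simp flip: factor_Add factor_Scal)

lemma pullback_ideal:
  assumes "is_ideal F J"
  shows "is_ideal (G_alg d) {a \<in> Gcarr d. cs a \<in> J}"
  using assms pullback_subspace[of J]
  by (auto simp: is_ideal_def Gcarr_mult factor_simps simp flip: factor_Mult)

text \<open>Each endomorphism of \<open>G_alg d\<close> induces one of the factor algebra. Lower
  bounds for a T-ideal of the factor algebra can therefore be computed with polynomials.\<close>

lemma pullback_T_ideal:
  assumes J: "is_T_ideal F J"
  shows "is_T_ideal (G_alg d) {a \<in> Gcarr d. cs a \<in> J}"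
  unfolding is_T_ideal_def
proof (intro conjI ballI subsetI)
  show "is_ideal (G_alg d) {a \<in> Gcarr d. cs a \<in> J}"
    using J by (intro pullback_ideal) (rule is_T_idealD)
  fix \<phi> x assume phi: "\<phi> \<in> endos (G_alg d)" and "x \<in> \<phi> ` {a \<in> Gcarr d. cs a \<in> J}"
  then obtain a where a: "a \<in> Gcarr d" "cs a \<in> J" "x = \<phi> a" by blast
  then show "x \<in> {a \<in> Gcarr d. cs a \<in> J}"
    using phi is_T_idealD(2)[OF J factor_map_in_endos[OF phi] a(2)]
    by (simp add: factor_map_coset endos_def)
qed

lemma pullback_contains:
  assumes "is_subspace F J"
  shows "I \<subseteq> {a \<in> Gcarr d. cs a \<in> J}"
proof
  fix a assume "a \<in> I"
  then have "cs a = cs 0" by (simp add: coset_eq_iff)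
  then show "a \<in> {a \<in> Gcarr d. cs a \<in> J}"
    using assms \<open>a \<in> I\<close> I_sub by (auto simp: is_subspace_def factor_simps)
qed

lemma image_ideal:
  assumes "is_ideal (G_alg d) K"
  shows "is_ideal F (cs ` K)"
  using is_idealD[OF assms, unfolded G_alg_simps]
  by (intro is_idealI) (auto simp: factor_simps factor_Add factor_Scal factor_Mult subset_iff)

text \<open>The preimage of an ideal that contains the commutators of \<open>F\<close> is an ideal
  that contains the commutators of \<open>G_alg d\<close>.\<close>

lemma coset_in_commutator_ideal:
  assumes "f \<in> commutator_ideal (G_alg d)"
  shows "cs f \<in> commutator_ideal F"
proof -
  have "cs f \<in> J" if J: "is_ideal F J" "commutators F \<subseteq> J" for J
  proof -
    have "commutators (G_alg d) \<subseteq> {a \<in> Gcarr d. cs a \<in> J}"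
    proof
      fix x :: "'k gelem" assume "x \<in> commutators (G_alg d)"
      then obtain a b where ab: "a \<in> Gcarr d" "b \<in> Gcarr d"
        and x: "x = gmult a b + gscale (-1) (gmult b a)"
        unfolding commutators_def by auto
      have "cs x = Add F (Mult F (cs a) (cs b)) (Scal F (-1) (Mult F (cs b) (cs a)))"
        using ab by (simp add: x factor_Add factor_Scal factor_Mult)
      then have "cs x \<in> commutators F"
        using ab unfolding commutators_def factor_simps by blast
      then show "x \<in> {a \<in> Gcarr d. cs a \<in> J}"
        using J(2) ab by (auto simp: x intro: Gcarr_add Gcarr_scale Gcarr_mult)
    qed
    then show ?thesis
      using commutator_ideal_least[OF pullback_ideal[OF J(1)]] assms by blast
  qed
  then show ?thesis unfolding commutator_ideal_def by blast
qed

lemma commutator_ideal_image: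
  assumes "is_ideal (G_alg d) K" "commutators (G_alg d) \<subseteq> K"
  shows "commutator_ideal F \<subseteq> cs ` K"
proof (rule commutator_ideal_least[OF image_ideal[OF assms(1)]], rule)
  fix x assume "x \<in> commutators F"
  then obtain a b where ab: "a \<in> Gcarr d" "b \<in> Gcarr d"
    and x: "x = Add F (Mult F (cs a) (cs b)) (Scal F (-1) (Mult F (cs b) (cs a)))"
    unfolding commutators_def factor_simps by blast
  have "gmult a b + gscale (-1) (gmult b a) \<in> commutators (G_alg d)"
    using ab unfolding commutators_def G_alg_simps by blast
  then show "x \<in> cs ` K"
    using ab subsetD[OF assms(2)] by (simp add: x factor_Add factor_Scal factor_Mult)
qed

text \<open>The result for arbitrary algebras applies to the factor algebra itself, so its
  endomorphisms do not have to be lifted to \<open>G_alg d\<close>.\<close>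

lemma is_T_ideal_commutator_ideal_factor: "is_T_ideal F (commutator_ideal F)"
  by (rule is_T_ideal_commutator_ideal[OF is_ideal_factor]) (auto simp: factor_simps factor_Scal)

end

text \<open>The kernel of the projection of \<open>G\<^sub>d\<close> onto the free commutative associative algebra
  (both \<open>y\<^sub>i\<close> and \<open>z\<^sub>i\<close> become \<open>y\<^sub>i\<close>).\<close>

definition sym_kernel :: "nat \<Rightarrow> 'k::field_char_0 gelem set" where
  "sym_kernel d = {f \<in> Gcarr d. subst_yz py py (gY f) = 0}"

text \<open>Once y_i and z_i are identified, the left and the right reading of an element
  coincide.\<close>

lemma subst_gZ: "subst_yz py py (gZ f) = subst_yz py py (gY f)"
  by (simp add: gY_def gZ_def subst_add subst_lin)

lemma subst_minus: "subst_yz f g (- p) = - subst_yz f g p"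
  using subst_add[of f g "- p" p] by (simp add: eq_neg_iff_add_eq_0)

lemma subst_diff: "subst_yz f g (p - q) = subst_yz f g p - subst_yz f g q"
  using subst_add[of f g p "- q"] by (simp add: subst_minus)

lemma gY_gmult [simp]: "gY (gmult f g) = gY f * gZ g"
  by (simp add: gmult_gYZ)

lemma gY_0 [simp]: "gY 0 = 0"
  by (simp add: gY_def)

lemma Const_uminus: "Const (- c) = - Const c"
  by (simp add: Const_def single_uminus)

lemma is_ideal_sym_kernel: "is_ideal (G_alg d) (sym_kernel d)"
  unfolding sym_kernel_def
  by (rule is_idealI)
    (simp_all add: Gcarr_0 Gcarr_add Gcarr_scale Gcarr_mult subst_add subst_mult subst_gZ)

lemma commutators_sub_sym_kernel: "commutators (G_alg d) \<subseteq> sym_kernel d"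
proof
  fix x :: "'k::field_char_0 gelem" assume "x \<in> commutators (G_alg d)"
  then obtain a b where ab: "a \<in> Gcarr d" "b \<in> Gcarr d"
    and x: "x = gmult a b + gscale (-1) (gmult b a)"
    unfolding commutators_def G_alg_simps by blast
  have "subst_yz py py (gY x) = 0"
    by (simp add: x subst_diff subst_mult subst_gZ Const_uminus mult.commute)
  then show "x \<in> sym_kernel d"
    using ab by (simp add: sym_kernel_def) (simp add: x Gcarr_add Gcarr_scale Gcarr_mult)
qed


section \<open>A criterion for the equivalence of consequences\<close>

lemma gl_act_Ghom:
  assumes "f \<in> Ghom d n" shows "gl_act d g f \<in> Ghom d n"
proof -
  obtain v p where f: "f = (v, p)" by force
  have "Poly_Mapping.keys (subst_yz (gy d g) (gz d g) p) \<subseteq> {m. mdeg (fst m) + mdeg (snd m) = n}"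
    unfolding subst_alt
  proof (intro keys_subset_sum)
    fix m assume "m \<in> Poly_Mapping.keys p"
    then have m: "mdeg (fst m) + mdeg (snd m) = n"
      using assms f by (auto simp: Ghom_iff)
    have "Const (Poly_Mapping.lookup p m) * (evm (gy d g) (fst m) * evm (gz d g) (snd m))
      \<in> PB d (mdeg (fst m)) (mdeg (snd m))"
      using PB_mult[OF PB_Const PB_mult[OF PB_evm_y PB_evm_z]] by simp
    then show "Poly_Mapping.keys (Const (Poly_Mapping.lookup p m) *
        (evm (gy d g) (fst m) * evm (gz d g) (snd m))) \<subseteq> {m. mdeg (fst m) + mdeg (snd m) = n}"
      using m by (force simp: PB_def)
  qed
  moreover have "n \<noteq> 1 \<longrightarrow> gv d g v = 0"
    using assms by (auto simp: f Ghom_iff gv_def)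
  ultimately show ?thesis
    using assms gl_carr[of f d g] by (simp add: Ghom_iff f gl_act_alt)
qed

lemma gscale_snd: "snd (gscale c f) = Const c * snd f"
  by (simp add: gscale_def)

lemma gscale_fst_0: "fst f = 0 \<Longrightarrow> fst (gscale c f) = 0"
  using gscale_pol[of c "snd f"] by (cases f) (simp add: pol_def)

lemma is_subspace_Ghom: "is_subspace (G_alg d) (Ghom d n)"
  unfolding is_subspace_def G_alg_simps
proof (intro conjI ballI allI)
  show "Ghom d n \<subseteq> (Gcarr d :: 'k::field_char_0 gelem set)"
    by (simp add: subset_iff Ghom_iff)
qed (simp_all add: Ghom_iff Gcarr_0 Gcarr_add Gcarr_scale
    keys_subset_add keys_subset_Const_mult gscale_snd gscale_fst_0)

text \<open>Exhibits the generator as a value of the defining identity: the bracket is the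
  commutator of \<open>gx 1\<close> and \<open>gx 2\<close>.\<close>

lemma V_generator_eq:
  "pol ((Const a * py 1 + Const b * pz 1) * (py 1 * pz 2 - py 2 * pz 1)) =
   gscale a (gmult (gx 1) (pol (py 1 * pz 2 - py 2 * pz 1))) +
   gscale b (gmult (pol (py 1 * pz 2 - py 2 * pz 1)) (gx 1))"
  by (simp add: gmult_gYZ pol_add algebra_simps)

lemma bracket_in_Gcarr:
  assumes "i \<in> {1..d}" "j \<in> {1..d}"
  shows "pol (py i * pz j - py j * pz i) \<in> Gcarr d"
  using Gcarr_add[OF py_pz_in_Gcarr[OF assms] Gcarr_scale[OF py_pz_in_Gcarr[OF assms(2,1)], of "-1"]]
  by (simp add: gscale_minus pol_diff del: gscale_pol)

lemma is_T_ideal_V_ideal: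
  assumes "2 \<le> d" shows "is_T_ideal (G_alg d) (V_ideal d \<beta>)"
  unfolding V_ideal_def V_generator_eq
proof (rule is_T_ideal_T_ideal)
  have "gx 1 \<in> Gcarr d" "pol (py 1 * pz 2 - py 2 * pz 1) \<in> Gcarr d"
    using assms by (auto intro!: gx_in_Gcarr bracket_in_Gcarr)
  then show "{gscale (fst \<beta>) (gmult (gx 1) (pol (py 1 * pz 2 - py 2 * pz 1))) +
      gscale (snd \<beta>) (gmult (pol (py 1 * pz 2 - py 2 * pz 1)) (gx 1))} \<subseteq> Carr (G_alg d)"
    by (auto intro!: Gcarr_add Gcarr_scale Gcarr_mult)
qed (simp add: is_ideal_Gcarr)

text \<open>Since \<beta>2 = - \<beta>1, the generator is \<beta>1 times the commutator of
  \<open>gx 1\<close> with the bracket, and the commutator ideal is a T-ideal inside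
  \<open>sym_kernel\<close>.\<close>

lemma V_ideal_sub_sym_kernel:
  assumes d: "2 \<le> d" and b: "\<beta>1 + \<beta>2 = 0"
  shows "V_ideal d (\<beta>1, \<beta>2) \<subseteq> sym_kernel d"
proof -
  let ?x = "gx 1" and ?y = "pol (py 1 * pz 2 - py 2 * pz 1)"
  have xy: "?x \<in> Gcarr d" "?y \<in> Gcarr d"
    using d by (auto intro!: gx_in_Gcarr bracket_in_Gcarr)
  have T: "is_T_ideal (G_alg d) (commutator_ideal (G_alg d))"
    by (rule is_T_ideal_commutator_ideal) (simp_all add: is_ideal_Gcarr)
  have "gmult ?x ?y + gscale (-1) (gmult ?y ?x) \<in> commutators (G_alg d)"
    using xy unfolding commutators_def G_alg_simps by blast
  then have "gscale \<beta>1 (gmult ?x ?y + gscale (-1) (gmult ?y ?x)) \<in> commutator_ideal (G_alg d)"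
    using is_idealD(4)[OF is_T_idealD(1)[OF T]] commutators_in_ideal by fastforce
  moreover have "\<beta>2 = \<beta>1 * (-1)"
    using b by (simp add: eq_neg_iff_add_eq_0 add.commute)
  then have "gscale \<beta>2 f = gscale \<beta>1 (gscale (-1) f)" for f
    by (simp only: gscale_mult)
  ultimately have "V_ideal d (\<beta>1, \<beta>2) \<subseteq> commutator_ideal (G_alg d)"
    unfolding V_ideal_def V_generator_eq
    by (intro T_ideal_least[OF T]) (simp add: gscale_add_right)
  also have "\<dots> \<subseteq> sym_kernel d"
    by (rule commutator_ideal_least[OF is_ideal_sym_kernel commutators_sub_sym_kernel])
  finally show ?thesis .
qed

text \<open>The consequences stay in the commutator ideal of the factor algebra, which is covered by
  the image of \<open>sym_kernel\<close>. As \<open>V_ideal\<close> lies in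
  \<open>sym_kernel\<close> too, every representative \<open>h\<close> of such a coset does.\<close>

lemma consequences_in_sym_kernel:
  assumes d: "2 \<le> d" and b: "\<beta>1 + \<beta>2 = 0" and f: "f \<in> commutator_ideal (G_alg d)"
    and h: "img d (\<beta>1, \<beta>2) h \<in> T_ideal (GV d (\<beta>1, \<beta>2)) {img d (\<beta>1, \<beta>2) f}"
  shows "h \<in> sym_kernel d"
proof -
  interpret T_factor d "V_ideal d (\<beta>1, \<beta>2)"
    by unfold_locales (rule is_T_ideal_V_ideal[OF d])
  have "T_ideal F {cs f} \<subseteq> commutator_ideal F"
    by (rule T_ideal_least[OF is_T_ideal_commutator_ideal_factor]) (simp add: coset_in_commutator_ideal[OF f])
  also have "\<dots> \<subseteq> cs ` sym_kernel d"
    by (rule commutator_ideal_image[OF is_ideal_sym_kernel commutators_sub_sym_kernel])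
  finally obtain k where k: "k \<in> sym_kernel d" "cs h = cs k"
    using h unfolding GV_def img_def by blast
  have "h - k \<in> sym_kernel d"
    using k(2) V_ideal_sub_sym_kernel[OF d b] by (auto simp: coset_eq_iff)
  then have "(h - k) + k \<in> sym_kernel d"
    using is_idealD(3)[OF is_ideal_sym_kernel, of "h - k" d k] k(1) by simp
  then show ?thesis by simp
qed

text \<open>Both inclusions are pulled back to \<open>G_alg d\<close>. \<open>lower\<close> puts the
  list into the T-ideal; \<open>upper\<close> recovers every consequence from the list by linear
  combinations and the group action. \<open>Q\<close> records what is known about consequences:
  nothing if they fill the component, membership in \<open>sym_kernel\<close> otherwise.\<close>

lemma conseq_equivI:
  fixes \<beta> :: "'k::field_char_0 \<times> 'k"
  assumes d: "2 \<le> d" and f: "f \<in> Gcarr d" and L: "L \<subseteq> Ghom d (n + 1)"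
    and lower: "\<And>T. is_T_ideal (G_alg d) T \<Longrightarrow> V_ideal d \<beta> \<subseteq> T \<Longrightarrow> f \<in> T \<Longrightarrow> L \<subseteq> T"
    and Q: "\<And>h. h \<in> Ghom d (n + 1) \<Longrightarrow> img d \<beta> h \<in> T_ideal (GV d \<beta>) {img d \<beta> f} \<Longrightarrow> Q h"
    and upper: "\<And>M h. is_subspace (G_alg d) M \<Longrightarrow> (\<And>g p. g \<in> GL d \<Longrightarrow> p \<in> M \<Longrightarrow> gl_act d g p \<in> M)
      \<Longrightarrow> V_ideal d \<beta> \<subseteq> M \<Longrightarrow> L \<subseteq> M \<Longrightarrow> h \<in> Ghom d (n + 1) \<Longrightarrow> Q h \<Longrightarrow> h \<in> M"
  shows "conseq_equiv d \<beta> n f L"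
proof -
  interpret T_factor d "V_ideal d \<beta>"
    by unfold_locales (rule is_T_ideal_V_ideal[OF d])
  have GV: "GV d \<beta> = F" and img: "img d \<beta> = cs"
    by (simp_all add: GV_def img_def[abs_def])
  let ?T = "T_ideal F {cs f}"
  have T: "is_T_ideal F ?T"
    using f by (intro is_T_ideal_T_ideal is_ideal_factor) (simp add: factor_simps)
  have hom_sub: "Ghom d m \<subseteq> (Gcarr d :: 'k gelem set)" for m
    by (auto simp: Ghom_iff)
  have gl: "gl_act_V d \<beta> g (cs a) = cs (gl_act d g a)" if "a \<in> Gcarr d" for g and a :: "'k gelem"
    unfolding gl_act_V_def by (rule factor_map_coset[OF gl_act_in_endos that])
  have "cs ` L \<subseteq> ?T"
  proof -
    have "L \<subseteq> {a \<in> Gcarr d. cs a \<in> ?T}"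
    proof (rule lower)
      show "is_T_ideal (G_alg d) {a \<in> Gcarr d. cs a \<in> ?T}"
        by (rule pullback_T_ideal[OF T])
      show "V_ideal d \<beta> \<subseteq> {a \<in> Gcarr d. cs a \<in> ?T}"
        using T by (intro pullback_contains) (simp add: is_T_ideal_def is_ideal_def)
      show "f \<in> {a \<in> Gcarr d. cs a \<in> ?T}"
        using f T_ideal_incl[of "{cs f}" F] by simp
    qed
    then show ?thesis by blast
  qed
  \<comment> \<open>The group acts through endomorphisms, which preserve the T-ideal, and it
    preserves the degree.\<close>
  have "is_GL_submodule d \<beta> (?T \<inter> cs ` Ghom d (n + 1))"
    unfolding is_GL_submodule_def GV
  proof (intro conjI ballI)
    have "is_subspace F (cs ` Ghom d (n + 1))"
      using is_subspace_Ghom[of d "n + 1"]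
      by (auto simp: is_subspace_def factor_simps factor_Add factor_Scal)
    moreover have "is_subspace F ?T"
      using T by (simp add: is_T_ideal_def is_ideal_def)
    ultimately show "is_subspace F (?T \<inter> cs ` Ghom d (n + 1))"
      unfolding is_subspace_def by blast
    fix g :: "'k mat" assume "g \<in> GL d"
    have "gl_act_V d \<beta> g x \<in> ?T" if "x \<in> ?T" for x
      unfolding gl_act_V_def by (rule is_T_idealD(2)[OF T factor_map_in_endos[OF gl_act_in_endos] that])
    moreover have "gl_act_V d \<beta> g (cs a) \<in> cs ` Ghom d (n + 1)" if "a \<in> Ghom d (n + 1)" for a :: "'k gelem"
      using that hom_sub gl[of a g] gl_act_Ghom[OF that, of g] by auto
    ultimately show "gl_act_V d \<beta> g ` (?T \<inter> cs ` Ghom d (n + 1)) \<subseteq> ?T \<inter> cs ` Ghom d (n + 1)"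
      by blast
  qed
  then have "GL_submodule d \<beta> (cs ` L) \<subseteq> ?T \<inter> cs ` Ghom d (n + 1)"
    unfolding GL_submodule_def using \<open>cs ` L \<subseteq> ?T\<close> L by blast
  moreover have "?T \<inter> cs ` Ghom d (n + 1) \<subseteq> M" if M: "is_GL_submodule d \<beta> M" "cs ` L \<subseteq> M" for M
  proof
    fix x assume "x \<in> ?T \<inter> cs ` Ghom d (n + 1)"
    then obtain h where h: "h \<in> Ghom d (n + 1)" "cs h \<in> ?T" "x = cs h" by blast
    have sub: "is_subspace F M"
      using M(1) by (simp add: is_GL_submodule_def GV)
    have "h \<in> {a \<in> Gcarr d. cs a \<in> M}"
    proof (rule upper)
      show "is_subspace (G_alg d) {a \<in> Gcarr d. cs a \<in> M}"
        by (rule pullback_subspace[OF sub])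
      show "V_ideal d \<beta> \<subseteq> {a \<in> Gcarr d. cs a \<in> M}"
        by (rule pullback_contains[OF sub])
      show "L \<subseteq> {a \<in> Gcarr d. cs a \<in> M}"
        using L hom_sub M(2) by blast
      show "gl_act d g p \<in> {a \<in> Gcarr d. cs a \<in> M}" if "g \<in> GL d" "p \<in> {a \<in> Gcarr d. cs a \<in> M}" for g p
        using that M(1) gl[of p g] gl_carr[of p d g] unfolding is_GL_submodule_def by force
      show "Q h" using Q h unfolding GV img by blast
    qed (rule h(1))
    then show "x \<in> M" using h by simp
  qed
  then have "?T \<inter> cs ` Ghom d (n + 1) \<subseteq> GL_submodule d \<beta> (cs ` L)"
    unfolding GL_submodule_def by (intro Inter_greatest) simp
  ultimately show ?thesis
    unfolding conseq_equiv_def consequences_def GV img by (intro equalityI)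
qed

section \<open>Derivations from shears\<close>

lemma Const_of_nat: "Const (of_nat n) = of_nat n"
  by (induct n) (simp_all add: Const_add)

locale poly_subspace =
  fixes M :: "'k::field_char_0 yzpoly set"
  assumes M_0: "0 \<in> M" and M_add: "p \<in> M \<Longrightarrow> q \<in> M \<Longrightarrow> p + q \<in> M"
    and M_Const: "p \<in> M \<Longrightarrow> Const c * p \<in> M"
begin

lemma M_uminus: "p \<in> M \<Longrightarrow> - p \<in> M"
  using M_Const[of p "-1"] by (simp add: Const_uminus)

lemma M_diff: "p \<in> M \<Longrightarrow> q \<in> M \<Longrightarrow> p - q \<in> M"
  using M_add[OF _ M_uminus] by fastforce

lemma M_sum: "(\<And>s. s \<in> S \<Longrightarrow> h s \<in> M) \<Longrightarrow> sum h S \<in> M"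
  by (induct S rule: infinite_finite_induct) (simp_all add: M_0 M_add)

lemma M_cancel_Const:
  assumes "Const c * p \<in> M" "c \<noteq> 0" shows "p \<in> M"
proof -
  have "Const (inverse c) * (Const c * p) \<in> M" by (rule M_Const[OF assms(1)])
  also have "Const (inverse c) * (Const c * p) = Const (inverse c * c) * p"
    by (simp only: Const_mult mult.assoc)
  finally show ?thesis using assms(2) by simp
qed

lemma M_of_nat: "p \<in> M \<Longrightarrow> of_nat n * p \<in> M"
  using M_Const[of p "of_nat n"] by (simp add: Const_of_nat)

text \<open>Characteristic 0 enters here: derivations and linearizations produce positive integer
  factors, which are removed in this form.\<close>

lemma M_cancel_of_nat: "of_nat (Suc n) * p \<in> M \<Longrightarrow> p \<in> M"
  using M_cancel_Const[of "of_nat (Suc n)" p] by (simp only: Const_of_nat of_nat_eq_0_iff)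

text \<open>A Vandermonde argument: \<open>q(2c) - 2\<^sup>n\<^sup>+\<^sup>1 q(c)\<close> has degree at most \<open>n\<close>.\<close>

lemma M_coefficients:
  assumes "\<And>c. (\<Sum>k\<le>n. Const (c ^ k) * h k) \<in> M" and "k \<le> n"
  shows "h k \<in> M"
  using assms
proof (induct n arbitrary: h k)
  case 0
  from 0(1)[of 1] 0(2) show ?case by simp
next
  case (Suc n)
  have low: "h k \<in> M" if "k \<le> n" for k
  proof -
    have "Const (2 ^ k - 2 ^ Suc n) * h k \<in> M"
    proof (rule Suc(1)[OF _ that])
      fix c :: 'k
      have "(\<Sum>k\<le>Suc n. Const ((2 * c) ^ k) * h k) - Const (2 ^ Suc n) * (\<Sum>k\<le>Suc n. Const (c ^ k) * h k) \<in> M"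
        by (intro M_diff M_Const Suc(2))
      also have "(\<Sum>k\<le>Suc n. Const ((2 * c) ^ k) * h k) - Const (2 ^ Suc n) * (\<Sum>k\<le>Suc n. Const (c ^ k) * h k)
        = (\<Sum>k\<le>Suc n. Const (c ^ k) * (Const (2 ^ k - 2 ^ Suc n) * h k))"
        unfolding sum_distrib_left sum_subtractf[symmetric]
      proof (rule sum.cong[OF refl])
        fix k
        have "Const ((2 * c) ^ k) = Const (c ^ k) * Const (2 ^ k :: 'k)"
          by (simp add: power_mult_distrib Const_mult mult.commute)
        moreover have "Const (2 ^ k - 2 ^ Suc n :: 'k) = Const (2 ^ k) - Const (2 ^ Suc n)"
          using Const_add[of "2 ^ k" "- (2 ^ Suc n) :: 'k"] by (simp add: Const_uminus)
        ultimately show "Const ((2 * c) ^ k) * h k - Const (2 ^ Suc n) * (Const (c ^ k) * h k) =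
          Const (c ^ k) * (Const (2 ^ k - 2 ^ Suc n) * h k)"
          by (simp only: left_diff_distrib right_diff_distrib ac_simps)
      qed
      also have "\<dots> = (\<Sum>k\<le>n. Const (c ^ k) * (Const (2 ^ k - 2 ^ Suc n) * h k))"
        by simp
      finally show "(\<Sum>k\<le>n. Const (c ^ k) * (Const (2 ^ k - 2 ^ Suc n) * h k)) \<in> M" .
    qed
    moreover have "(2::'k) ^ k - 2 ^ Suc n \<noteq> 0"
    proof
      assume "(2::'k) ^ k - 2 ^ Suc n = 0"
      then have "of_nat (2 ^ k) = (of_nat (2 ^ Suc n) :: 'k)" by simp
      then have "(2::nat) ^ k = 2 ^ Suc n" by (simp only: of_nat_eq_iff)
      with that show False using power_inject_exp[of "2::nat" k "Suc n"] by simp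
    qed
    ultimately show ?thesis by (rule M_cancel_Const)
  qed
  show ?case
  proof (cases "k = Suc n")
    case True
    \<comment> \<open>The value at 1 is the sum of all coefficients; subtracting the lower ones
      leaves the top one.\<close>
    have "(\<Sum>k\<le>Suc n. Const (1 ^ k) * h k) - (\<Sum>k\<le>n. h k) \<in> M"
      by (intro M_diff Suc(2) M_sum low) simp
    then show ?thesis using True by simp
  qed (use Suc(3) low in simp)
qed

text \<open>\<open>q\<close> is a polynomial in the parameter of the shear, with coefficients in the
  polynomial algebra; its values at scalars alone determine the coefficients.\<close>

lemma M_coeff:
  assumes "\<And>c. poly q (Const c) \<in> M" shows "coeff q k \<in> M"
proof (cases "k \<le> degree q")
  case True
  have "Const c ^ k = Const (c ^ k)" for c :: 'k and k
    by (induct k) (simp_all add: Const_mult)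
  then have "(\<Sum>k\<le>degree q. Const (c ^ k) * coeff q k) \<in> M" for c
    using assms[of c] by (simp add: poly_altdef mult.commute)
  then show ?thesis using True by (rule M_coefficients)
qed (simp add: coeff_eq_0 M_0)

end

text \<open>The action of this matrix is x_i -> x_i + c x_j. Column \<open>i - 1\<close> holds the
  image of x_i, so \<open>c\<close> stands in row \<open>j - 1\<close> and column
  \<open>i - 1\<close>.\<close>

definition shear :: "nat \<Rightarrow> nat \<Rightarrow> nat \<Rightarrow> 'k::field_char_0 \<Rightarrow> 'k mat" where
  "shear d i j c = addrow_mat d c (j - 1) (i - 1)"

text \<open>\<open>Der d i j p p'\<close> says that \<open>p'\<close> is the image of \<open>p\<close> under the derivation with
  \<open>y\<^sub>i \<mapsto> y\<^sub>j\<close>, \<open>z\<^sub>i \<mapsto> z\<^sub>j\<close> that kills all other variables: it is the linear term in \<open>c\<close> of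
  the action of the shear \<open>x\<^sub>i \<mapsto> x\<^sub>i + c x\<^sub>j\<close>.\<close>

definition Der :: "nat \<Rightarrow> nat \<Rightarrow> nat \<Rightarrow> 'k::field_char_0 yzpoly \<Rightarrow> 'k yzpoly \<Rightarrow> bool" where
  "Der d i j p p' \<longleftrightarrow> (\<exists>q. coeff q 0 = p \<and> coeff q 1 = p' \<and>
     (\<forall>c. subst_yz (gy d (shear d i j c)) (gz d (shear d i j c)) p = poly q (Const c)))"

lemma shear_in_GL:
  fixes c :: "'k::field_char_0"
  assumes "i \<in> {1..d}" "j \<in> {1..d}" "i \<noteq> j"
  shows "shear d i j c \<in> GL d"
proof -
  have ij: "j - 1 < d" "i - 1 < d" "j - 1 \<noteq> i - 1" using assms by auto
  have "addrow_mat d c (j - 1) (i - 1) * addrow_mat d (- c) (j - 1) (i - 1) = 1\<^sub>m d" for c :: 'k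
    using ij by (intro addrow_mat_inv)
  from this[of c] this[of "- c"] have "invertible_mat (shear d i j c)"
    unfolding invertible_mat_def inverts_mat_def
    by (intro conjI exI[of _ "shear d i j (- c)"]) (simp_all add: shear_def)
  then show ?thesis by (simp add: GL_def shear_def)
qed

lemma shear_linear:
  assumes "i \<in> {1..d}" "j \<in> {1..d}" "i \<noteq> j" "k \<in> {1..d}"
  shows "(\<Sum>r\<in>{1..d}. Const (shear d i j c $$ (r - 1, k - 1)) * F r) =
    (if k = i then F i + Const c * F j else F k)"
proof -
  have "Const (shear d i j c $$ (r - 1, k - 1)) * F r =
    (if r = k then F k else 0) + (if r = j then (if k = i then Const c * F j else 0) else 0)"
    if "r \<in> {1..d}" for r
  proof -
    have "r - 1 < d" "k - 1 < d" "r - 1 = k - 1 \<longleftrightarrow> r = k" "j - 1 = r - 1 \<longleftrightarrow> r = j" "i - 1 = k - 1 \<longleftrightarrow> k = i"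
      using assms that by auto
    then show ?thesis using assms(3) by (auto simp: shear_def addrow_mat_def)
  qed
  then have "(\<Sum>r\<in>{1..d}. Const (shear d i j c $$ (r - 1, k - 1)) * F r) =
    (\<Sum>r\<in>{1..d}. (if r = k then F k else 0) + (if r = j then (if k = i then Const c * F j else 0) else 0))"
    by (rule sum.cong[OF refl])
  also have "\<dots> = (if k = i then F i + Const c * F j else F k)"
    using assms by (simp add: sum.distrib)
  finally show ?thesis .
qed

lemma Der_py:
  assumes "i \<in> {1..d}" "j \<in> {1..d}" "i \<noteq> j" "k \<in> {1..d}"
  shows "Der d i j (py k) (if k = i then py j else 0)"
  unfolding Der_def
  by (rule exI[of _ "[:py k, if k = i then py j else 0:]"])
    (simp add: gy_def shear_linear[OF assms, unfolded One_nat_def])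

lemma Der_pz:
  assumes "i \<in> {1..d}" "j \<in> {1..d}" "i \<noteq> j" "k \<in> {1..d}"
  shows "Der d i j (pz k) (if k = i then pz j else 0)"
  unfolding Der_def
  by (rule exI[of _ "[:pz k, if k = i then pz j else 0:]"])
    (simp add: gz_def shear_linear[OF assms, unfolded One_nat_def])

lemma subst_1: "subst_yz f g 1 = 1"
  using subst_Const[of f g 1] by simp

lemma Der_1: "Der d i j 1 0"
  unfolding Der_def by (intro exI[of _ 1]) (simp add: subst_1)

lemma Der_diff:
  assumes "Der d i j p p'" "Der d i j q q'" shows "Der d i j (p - q) (p' - q')"
proof -
  from assms obtain P Q where
    "coeff P 0 = p" "coeff P 1 = p'" "\<forall>c. subst_yz (gy d (shear d i j c)) (gz d (shear d i j c)) p = poly P (Const c)"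
    "coeff Q 0 = q" "coeff Q 1 = q'" "\<forall>c. subst_yz (gy d (shear d i j c)) (gz d (shear d i j c)) q = poly Q (Const c)"
    unfolding Der_def by blast
  then show ?thesis unfolding Der_def by (intro exI[of _ "P - Q"]) (simp add: subst_diff)
qed

lemma Der_mult:
  assumes "Der d i j p p'" "Der d i j q q'" shows "Der d i j (p * q) (p * q' + p' * q)"
proof -
  from assms obtain P Q where
    "coeff P 0 = p" "coeff P 1 = p'" "\<forall>c. subst_yz (gy d (shear d i j c)) (gz d (shear d i j c)) p = poly P (Const c)"
    "coeff Q 0 = q" "coeff Q 1 = q'" "\<forall>c. subst_yz (gy d (shear d i j c)) (gz d (shear d i j c)) q = poly Q (Const c)"
    unfolding Der_def by blast
  then show ?thesis
    unfolding Der_def by (intro exI[of _ "P * Q"]) (simp add: subst_mult coeff_mult)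
qed

lemma Der_power:
  assumes "Der d i j p p'" shows "Der d i j (p ^ n) (of_nat n * p ^ (n - 1) * p')"
proof (induct n)
  case (Suc n)
  from Der_mult[OF assms Suc] show ?case
    by (cases n) (simp_all add: algebra_simps)
qed (simp add: Der_1)

lemma yz_mono_add_y: "yz_mono (a + Poly_Mapping.single i 1) b = yz_mono a b * py i"
  by (simp add: yz_mono_def py_def mult_single)

lemma yz_mono_add_z: "yz_mono a (b + Poly_Mapping.single i 1) = yz_mono a b * pz i"
  by (simp add: yz_mono_def pz_def mult_single)

lemma yz_mono_0: "yz_mono 0 0 = 1"
  by (simp add: yz_mono_def flip: zero_prod_def)

lemma yz_mono_pow: "yz_mono (Poly_Mapping.single i n) 0 = (py i ^ n :: 'k::field_char_0 yzpoly)"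
proof (induct n)
  case (Suc n)
  then show ?case
    using yz_mono_add_y[of "Poly_Mapping.single i n" i 0, where ?'a = 'k] by (simp add: mult.commute single_add[symmetric])
qed (simp add: yz_mono_0)

text \<open>Subtraction of exponents is truncated; if y_i does not occur in the monomial, the
  coefficient 0 removes the meaningless term.\<close>

lemma Der_yz_mono:
  assumes ij: "i \<in> {1..d}" "j \<in> {1..d}" "i \<noteq> j" and a: "Poly_Mapping.keys a \<subseteq> {1..d}"
  shows "Der d i j (yz_mono a 0 :: 'k::field_char_0 yzpoly)
    (of_nat (Poly_Mapping.lookup a i) * (yz_mono (a - Poly_Mapping.single i 1) 0 * py j))"
  using a
proof (induct a rule: exponent_induct)
  case zero
  then show ?case by (simp add: yz_mono_0 Der_1)
next
  case (add a k)
  then have k: "k \<in> {1..d}" and IH: "Der d i j (yz_mono a 0 :: 'k yzpoly)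
    (of_nat (Poly_Mapping.lookup a i) * (yz_mono (a - Poly_Mapping.single i 1) 0 * py j))"
    by (auto simp: keys_add_nat)
  let ?r = "(yz_mono a 0 :: 'k yzpoly) * (if k = i then py j else 0) +
    of_nat (Poly_Mapping.lookup a i) * (yz_mono (a - Poly_Mapping.single i 1) 0 * py j) * py k"
  have D: "Der d i j (yz_mono (a + Poly_Mapping.single k 1) 0) ?r"
    unfolding yz_mono_add_y by (rule Der_mult[OF IH Der_py[OF ij k]])
  have "of_nat (Poly_Mapping.lookup a i) * ((yz_mono (a - Poly_Mapping.single i 1) 0 :: 'k yzpoly) * py k) =
      of_nat (Poly_Mapping.lookup a i) * yz_mono (a + Poly_Mapping.single k 1 - Poly_Mapping.single i 1) 0"
  proof (cases "Poly_Mapping.lookup a i = 0")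
    case False
    then have "a + Poly_Mapping.single k 1 - Poly_Mapping.single i 1 = a - Poly_Mapping.single i 1 + Poly_Mapping.single k 1"
      by (auto intro!: poly_mapping_eqI simp: lookup_add lookup_minus lookup_single when_def)
    then show ?thesis by (simp only: yz_mono_add_y)
  qed simp
  then have "?r = of_nat (Poly_Mapping.lookup (a + Poly_Mapping.single k 1) i) *
    (yz_mono (a + Poly_Mapping.single k 1 - Poly_Mapping.single i 1) 0 * py j)"
    by (auto simp: lookup_add lookup_single algebra_simps)
  with D show ?case by simp
qed

section \<open>Submodules modulo the identities of the variety\<close>

abbreviation tt :: "nat \<Rightarrow> 'k::field_char_0 yzpoly" where "tt i \<equiv> py i - pz i"
abbreviation br :: "nat \<Rightarrow> nat \<Rightarrow> 'k::field_char_0 yzpoly" where "br i j \<equiv> py i * pz j - py j * pz i"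
abbreviation ym :: "(nat \<Rightarrow>\<^sub>0 nat) \<Rightarrow> 'k::field_char_0 yzpoly" where "ym a \<equiv> yz_mono a 0"
abbreviation ex :: "nat \<Rightarrow> (nat \<Rightarrow>\<^sub>0 nat)" where "ex i \<equiv> Poly_Mapping.single i 1"

lemma yz_mono_decomp:
  "(\<Sum>m\<in>Poly_Mapping.keys p. Const (Poly_Mapping.lookup p m) * yz_mono (fst m) (snd m)) = p"
  by (subst (3) pm_decomp[of p]) (simp add: yz_mono_def Const_def mult_single)

locale gl_subspace = poly_subspace M for M :: "'k::field_char_0 yzpoly set" +
  fixes d :: nat
  assumes d2: "2 \<le> d"
    and gl: "g \<in> GL d \<Longrightarrow> p \<in> M \<Longrightarrow> subst_yz (gy d g) (gz d g) p \<in> M"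
begin

text \<open>The shears of \<open>p\<close> form a polynomial in the parameter with values in
  \<open>M\<close>, so its linear coefficient lies in \<open>M\<close>: stability under the group
  gives stability under the derivations.\<close>

lemma M_Der:
  assumes "Der d i j p p'" "p \<in> M" "i \<in> {1..d}" "j \<in> {1..d}" "i \<noteq> j"
  shows "p' \<in> M"
proof -
  obtain q where q: "coeff q 1 = p'"
    "\<And>c. subst_yz (gy d (shear d i j c)) (gz d (shear d i j c)) p = poly q (Const c)"
    using assms(1) unfolding Der_def by blast
  have "poly q (Const c) \<in> M" for c
    using gl[OF shear_in_GL[OF assms(3-5)] assms(2), of c] q(2) by simp
  then have "coeff q 1 \<in> M" by (rule M_coeff)
  with q(1) show ?thesis by simp
qed

lemma one_two: "1 \<in> {1..d}" "2 \<in> {1..d}"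
  using d2 by auto

text \<open>Spreads one element over all Y z_k F with Y of degree \<open>r\<close>. The derivations
  out of index 1 treat \<open>F\<close> as a constant, and \<open>swap\<close> makes Y y_p z_q F
  symmetric in p and q modulo \<open>M\<close>, so the terms of a derivative combine into a positive
  multiple of a single one.\<close>

lemma polarize:
  assumes F: "\<And>k. k \<in> {2..d} \<Longrightarrow> Der d 1 k F 0"
    and swap: "\<And>a p q. Poly_Mapping.keys a \<subseteq> {1..d} \<Longrightarrow> mdeg a + 1 = r \<Longrightarrow> p \<in> {1..d} \<Longrightarrow> q \<in> {1..d} \<Longrightarrow>
      ym a * br p q * F \<in> M"
    and start: "py 1 ^ r * pz 1 * F \<in> M"
    and a: "Poly_Mapping.keys a \<subseteq> {1..d}" "mdeg a = r" and k: "k \<in> {1..d}"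
  shows "ym a * pz k * F \<in> M"
proof -
  \<comment> \<open>The derivation with y_1 -> y_k and z_1 -> z_k, applied to Y z_1 F.\<close>
  have D: "ym a * pz k * F + of_nat (Poly_Mapping.lookup a 1) * (ym (a - ex 1) * py k * pz 1 * F) \<in> M"
    if "ym a * pz 1 * F \<in> M" "Poly_Mapping.keys a \<subseteq> {1..d}" "k \<in> {2..d}" for a k
  proof -
    have k: "k \<in> {1..d}" "1 \<noteq> k" using that(3) by auto
    have "Der d 1 k (ym a * pz 1 * F) ((ym a * pz 1) * 0 +
        (ym a * (if 1 = (1::nat) then pz k else 0) + of_nat (Poly_Mapping.lookup a 1) * (ym (a - ex 1) * py k) * pz 1) * F)"
      by (rule Der_mult[OF Der_mult[OF Der_yz_mono[OF one_two(1) k that(2)] Der_pz[OF one_two(1) k one_two(1)]] F[OF that(3)]])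
    from M_Der[OF this that(1) one_two(1) k] show ?thesis
      by (simp add: algebra_simps)
  qed
  have one: "ym a * pz 1 * F \<in> M" if "Poly_Mapping.keys a \<subseteq> {1..d}" "mdeg a = r" for a
    using that
  \<comment> \<open>The induction runs over the number of letters of Y other than y_1; the pure
    power of y_1 is the element \<open>start\<close>.\<close>
  proof (induct "r - Poly_Mapping.lookup a 1" arbitrary: a rule: less_induct)
    case less
    show ?case
    proof (cases "Poly_Mapping.keys a \<subseteq> {1}")
      case True
      have "Poly_Mapping.lookup a 1 = mdeg a"
        using mdeg_super[OF _ True] by simp
      then have "a = Poly_Mapping.single 1 r"
        using True less(3) by (intro poly_mapping_eqI) (auto simp: lookup_single when_def in_keys_iff)
      then show ?thesis using start by (simp add: yz_mono_pow)
    next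
      case False
      then obtain k where k: "k \<in> Poly_Mapping.keys a" "k \<noteq> 1" by auto
      then have kd: "k \<in> {2..d}" "k \<in> {1..d}" using less(2) by (auto simp: subset_iff)
      obtain b where b: "a = b + ex k" using k(1) by (rule exponent_split)
      have bd: "Poly_Mapping.keys b \<subseteq> {1..d}" "mdeg b + 1 = r"
        using less(2,3) by (auto simp: b keys_add_nat mdeg_add)
      have "Poly_Mapping.lookup b 1 \<le> mdeg b"
        using bd(1) mdeg_super[OF finite_atLeastAtMost bd(1)] d2
        by (simp add: member_le_sum)
      then have "r - Poly_Mapping.lookup (b + ex 1) 1 < r - Poly_Mapping.lookup a 1"
        using k bd(2) by (simp add: b lookup_add lookup_single)
      moreover have b1: "Poly_Mapping.keys (b + ex 1) \<subseteq> {1..d}" "mdeg (b + ex 1) = r"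
        using bd d2 by (simp_all add: keys_add_nat mdeg_add)
      ultimately have "ym (b + ex 1) * pz 1 * F \<in> M" by (rule less(1))
      from D[OF this b1(1) kd(1)]
      have "ym b * py 1 * pz k * F + of_nat (Suc (Poly_Mapping.lookup b 1)) * (ym b * py k * pz 1 * F) \<in> M"
        by (simp add: yz_mono_add_y[unfolded One_nat_def] lookup_add)
      \<comment> \<open>Exchanging the indices 1 and k turns the first term into a further copy of
        the second, so the two add up with a nonzero coefficient.\<close>
      from M_diff[OF this swap[OF bd one_two(1) kd(2)]]
      have "of_nat (Suc (Suc (Poly_Mapping.lookup b 1))) * (ym b * py k * pz 1 * F) \<in> M"
        by (simp add: algebra_simps)
      then show ?thesis
        unfolding b yz_mono_add_y by (rule M_cancel_of_nat)
    qed
  qed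
  show ?thesis
  proof (cases "k = 1")
    case False
    then have k2: "k \<in> {2..d}" using k by auto
    \<comment> \<open>The correction term has z_1 as its z-factor, hence is covered by
      \<open>one\<close>.\<close>
    have "of_nat (Poly_Mapping.lookup a 1) * (ym (a - ex 1) * py k * pz 1 * F) \<in> M"
    proof (cases "Poly_Mapping.lookup a 1 = 0")
      case True
      then show ?thesis by (simp add: M_0)
    next
      case False
      then have "1 \<in> Poly_Mapping.keys a" by (simp add: in_keys_iff)
      then obtain b where b: "a = b + ex 1" by (rule exponent_split)
      have "ym (b + ex k) * pz 1 * F \<in> M"
        using a k by (intro one) (auto simp: b keys_add_nat mdeg_add)
      then show ?thesis
        by (intro M_of_nat) (simp add: b yz_mono_add_y[unfolded One_nat_def])
    qed
    from M_diff[OF D[OF one[OF a] a(1) k2] this] show ?thesis by simp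
  qed (simp add: one[OF a, unfolded One_nat_def])
qed

end

text \<open>\<open>rel1\<close> and \<open>rel2\<close> are the identities of the variety as they
  are used on polynomials. The multiplier in \<open>rel1\<close> is any monomial in the y_i,
  including 1; the one in \<open>rel2\<close> is a monomial of \<open>G_alg d\<close>.\<close>

locale V_subspace = gl_subspace +
  assumes rel1: "Poly_Mapping.keys a \<subseteq> {1..d} \<Longrightarrow> i \<in> {1..d} \<Longrightarrow> j \<in> {1..d} \<Longrightarrow> k \<in> {1..d} \<Longrightarrow>
      ym a * (tt k * br i j) \<in> M"
    and rel2: "(a, b) \<in> exps d \<Longrightarrow> i \<in> {1..d} \<Longrightarrow> j \<in> {1..d} \<Longrightarrow> yz_mono a b * (tt i * tt j) \<in> M"
begin

text \<open>This is the derivative of \<open>start\<close> along 1 -> 2, where \<open>rel1\<close>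
  moves the index 2 from y to z in the term with y_2.\<close>

lemma y1_power_t:
  assumes start: "py 1 ^ Suc r * pz 1 * tt 1 \<in> M"
  shows "of_nat (Suc (Suc r)) * (py 1 ^ Suc r * pz 2 * tt 1) + py 1 ^ Suc r * pz 1 * tt 2 \<in> M"
proof -
  have 12: "(1::nat) \<noteq> 2" by simp
  note i = one_two 12
  have "Der d 1 2 (py 1 ^ Suc r * pz 1 * tt 1)
    ((py 1 ^ Suc r * pz 1) * ((if 1 = (1::nat) then py 2 else 0) - (if 1 = (1::nat) then pz 2 else 0)) +
     (py 1 ^ Suc r * (if 1 = (1::nat) then pz 2 else 0) +
      (of_nat (Suc r) * py 1 ^ (Suc r - 1) * (if 1 = (1::nat) then py 2 else 0)) * pz 1) * tt 1)"
    by (intro Der_mult Der_diff Der_power Der_py Der_pz i)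
  from M_Der[OF this start i]
  have "py 1 ^ Suc r * pz 1 * tt 2 + py 1 ^ Suc r * pz 2 * tt 1 + of_nat (Suc r) * (py 1 ^ r * py 2 * pz 1 * tt 1) \<in> M"
    by (simp add: algebra_simps)
  moreover have "py 1 ^ r * (tt 1 * br 1 2) \<in> M"
    using rel1[of "Poly_Mapping.single 1 r" 1 2 1] i by (simp add: yz_mono_pow)
  then have "of_nat (Suc r) * (py 1 ^ r * (tt 1 * br 1 2)) \<in> M" by (rule M_of_nat)
  ultimately have "py 1 ^ Suc r * pz 1 * tt 2 + py 1 ^ Suc r * pz 2 * tt 1 + of_nat (Suc r) * (py 1 ^ r * py 2 * pz 1 * tt 1)
    + of_nat (Suc r) * (py 1 ^ r * (tt 1 * br 1 2)) \<in> M"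
    by (rule M_add)
  then show ?thesis by (simp add: algebra_simps)
qed

text \<open>\<open>polarize\<close> is applied with \<open>F = tt 2\<close> because the derivations
  out of index 1 kill \<open>tt 2\<close> but not \<open>tt 1\<close>; a derivation 2 -> j then
  replaces \<open>tt 2\<close> by \<open>tt j\<close>.\<close>

lemma all_W:
  assumes start: "py 1 ^ Suc r * pz 1 * tt 1 \<in> M" and b: "py 1 ^ Suc r * br 1 2 \<in> M"
    and a: "Poly_Mapping.keys a \<subseteq> {1..d}" "mdeg a = Suc r" and kj: "k \<in> {1..d}" "j \<in> {1..d}"
  shows "ym a * pz k * tt j \<in> M"
proof -
  \<comment> \<open>Identically \<open>br 1 2 = pz 2 * tt 1 - pz 1 * tt 2\<close>, so only a
    multiple of the term with \<open>tt 2\<close> is left, with coefficient r + 3.\<close>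
  have "of_nat (Suc (Suc r)) * (py 1 ^ Suc r * pz 2 * tt 1) + py 1 ^ Suc r * pz 1 * tt 2
    - of_nat (Suc (Suc r)) * (py 1 ^ Suc r * br 1 2) \<in> M"
    by (intro M_diff M_of_nat y1_power_t start b)
  then have "of_nat (Suc (Suc (Suc r))) * (py 1 ^ Suc r * pz 1 * tt 2) \<in> M"
    by (simp add: algebra_simps)
  then have s: "py 1 ^ Suc r * pz 1 * tt 2 \<in> M" by (rule M_cancel_of_nat)
  have two: "ym a * pz k * tt 2 \<in> M" if "Poly_Mapping.keys a \<subseteq> {1..d}" "mdeg a = Suc r" "k \<in> {1..d}" for a k
  proof (rule polarize[OF _ _ s that])
    fix k assume "k \<in> {2..d}"
    then have "1 \<in> {1..d}" "k \<in> {1..d}" "1 \<noteq> k" by auto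
    from Der_diff[OF Der_py[OF this one_two(2)] Der_pz[OF this one_two(2)]]
    show "Der d 1 k (tt 2 :: 'a yzpoly) 0" by simp
  next
    fix a :: "nat \<Rightarrow>\<^sub>0 nat" and p q assume "Poly_Mapping.keys a \<subseteq> {1..d}" "p \<in> {1..d}" "q \<in> {1..d}"
    then have "ym a * (tt 2 * br p q) \<in> M" by (intro rel1 one_two)
    then show "ym a * br p q * tt 2 \<in> M" by (simp add: ac_simps)
  qed
  show ?thesis
  proof (cases "j = 2")
    case False
    then have j: "2 \<noteq> j" by simp
    \<comment> \<open>Besides the wanted term, the derivative along 2 -> j has only terms that still
      end in \<open>tt 2\<close> and lie in \<open>M\<close> by \<open>two\<close>.\<close>
    let ?A = "of_nat (Poly_Mapping.lookup a 2) * (ym (a - ex 2) * py j * pz k * tt 2)"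
    have "Der d 2 j (ym a * pz k * tt 2)
      ((ym a * pz k) * ((if 2 = (2::nat) then py j else 0) - (if 2 = (2::nat) then pz j else 0)) +
       (ym a * (if k = 2 then pz j else 0) +
        (of_nat (Poly_Mapping.lookup a 2) * (ym (a - ex 2) * py j)) * pz k) * tt 2)"
      by (intro Der_mult Der_diff Der_yz_mono Der_py Der_pz one_two kj j a)
    from M_Der[OF this two[OF a kj(1)] one_two(2) kj(2) j]
    have "ym a * pz k * tt j + (if k = 2 then ym a * pz j * tt 2 else 0) + ?A \<in> M"
      by (simp add: algebra_simps split: if_splits)
    moreover have "(if k = 2 then ym a * pz j * tt 2 else 0) \<in> M"
      using two[OF a kj(2)] M_0 by simp
    moreover have "?A \<in> M"
    proof (cases "Poly_Mapping.lookup a 2 = 0")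
      case True
      then show ?thesis by (simp add: M_0)
    next
      case False
      then have "2 \<in> Poly_Mapping.keys a" by (simp add: in_keys_iff)
      then obtain b where b: "a = b + ex 2" by (rule exponent_split)
      have "ym (b + ex j) * pz k * tt 2 \<in> M"
        using a kj by (intro two) (auto simp: b keys_add_nat mdeg_add)
      then show ?thesis
        by (intro M_of_nat) (simp add: b yz_mono_add_y[unfolded One_nat_def])
    qed
    ultimately have "ym a * pz k * tt j + (if k = 2 then ym a * pz j * tt 2 else 0) + ?A
      - ?A - (if k = 2 then ym a * pz j * tt 2 else 0) \<in> M"
      by (intro M_diff)
    then show ?thesis by simp
  qed (simp add: two[OF a kj(1)])
qed

end

text \<open>Here \<open>r = m - 2\<close>, where \<open>m\<close> is the degree of the component considered.\<close>

locale W_subspace = V_subspace +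
  fixes r :: nat
  assumes W: "Poly_Mapping.keys a \<subseteq> {1..d} \<Longrightarrow> mdeg a = r \<Longrightarrow> k \<in> {1..d} \<Longrightarrow> j \<in> {1..d} \<Longrightarrow>
    ym a * pz k * tt j \<in> M"
begin

text \<open>\<open>br p q\<close> equals \<open>pz q * tt p - pz p * tt q\<close>.\<close>

lemma swap:
  assumes "Poly_Mapping.keys a \<subseteq> {1..d}" "mdeg a = r" "p \<in> {1..d}" "q \<in> {1..d}"
  shows "ym a * br p q \<in> M"
  using M_diff[OF W[OF assms(1,2,4,3)] W[OF assms]] by (simp add: algebra_simps)

text \<open>In front of \<open>tt j\<close>, \<open>rel2\<close> allows z_q to be replaced by y_q as
  long as another z remains. This ends with one z, where \<open>W\<close> applies.\<close>

lemma mono_t: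
  assumes "(a, b) \<in> exps d" "mdeg a + mdeg b = Suc r" "j \<in> {1..d}"
  shows "yz_mono a b * tt j \<in> M"
  using assms(1,2)
proof (induct "mdeg b" arbitrary: a b)
  case 0
  then show ?case by (simp add: exps_def)
next
  case (Suc n)
  from Suc(2) have "b \<noteq> 0" by auto
  then obtain q where q: "q \<in> Poly_Mapping.keys b" by fastforce
  then obtain b' where b: "b = b' + ex q" by (rule exponent_split)
  have qd: "q \<in> {1..d}" using Suc(3) q by (auto simp: exps_def)
  show ?case
  proof (cases "b' = 0")
    case True
    have "ym a * pz q * tt j \<in> M"
      using Suc(3,4) qd assms(3) by (intro W) (simp_all add: exps_def b True)
    then show ?thesis using yz_mono_add_z[of a 0 q, where ?'a = 'a] by (simp add: b True)
  next
    case False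
    then have n: "1 \<le> mdeg b'"
      by (metis ex_in_conv keys_eq_empty mdeg_def sum_eq_0_iff finite_keys in_keys_iff less_one not_le)
    have e: "(a + ex q, b') \<in> exps d" "(a, b') \<in> exps d"
      using Suc(3) n qd by (auto simp: exps_def b keys_add_nat mdeg_add)
    have "yz_mono (a + ex q) b' * tt j \<in> M"
      using Suc(2,4) e(1) by (intro Suc(1)) (simp_all add: b mdeg_add)
    from M_diff[OF this rel2[OF e(2) qd assms(3)]] show ?thesis
      unfolding b yz_mono_add_y yz_mono_add_z by (simp add: algebra_simps)
  qed
qed

text \<open>By \<open>mono_t\<close> a factor z_q may be replaced by y_q while another z remains.
  The replacement keeps \<open>a + b\<close>, the commutative image of the monomial, so the result
  is expressed through it.\<close>

lemma mono_normal:
  assumes "(a, b) \<in> exps d" "mdeg a + mdeg b = Suc (Suc r)"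
  shows "\<exists>p\<in>Poly_Mapping.keys (a + b). yz_mono a b - ym (a + b - ex p) * pz p \<in> M"
  using assms
proof (induct "mdeg b" arbitrary: a b)
  case 0
  then show ?case by (simp add: exps_def)
next
  case (Suc n)
  from Suc(2) have "b \<noteq> 0" by auto
  then obtain q where q: "q \<in> Poly_Mapping.keys b" by fastforce
  then obtain b' where b: "b = b' + ex q" by (rule exponent_split)
  have qd: "q \<in> {1..d}" using Suc(3) q by (auto simp: exps_def)
  show ?case
  proof (cases "b' = 0")
    case True
    show ?thesis
      using yz_mono_add_z[of a 0 q, where ?'a = 'a]
      by (intro bexI[of _ q]) (simp_all add: b True M_0 keys_add_nat)
  next
    case False
    then have n: "1 \<le> mdeg b'"
      by (metis ex_in_conv keys_eq_empty mdeg_def sum_eq_0_iff finite_keys in_keys_iff less_one not_le)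
    have e: "(a + ex q, b') \<in> exps d" "(a, b') \<in> exps d"
      using Suc(3) n qd by (auto simp: exps_def b keys_add_nat mdeg_add)
    have ab: "a + ex q + b' = a + b" by (simp add: b ac_simps)
    have "\<exists>p\<in>Poly_Mapping.keys (a + ex q + b'). yz_mono (a + ex q) b' - ym (a + ex q + b' - ex p) * pz p \<in> M"
      using Suc(2,4) e(1) by (intro Suc(1)) (simp_all add: b mdeg_add)
    then obtain p where p: "p \<in> Poly_Mapping.keys (a + b)"
      "yz_mono (a + ex q) b' - ym (a + b - ex p) * pz p \<in> M"
      unfolding ab by blast
    have "yz_mono a b' * tt q \<in> M"
      using Suc(4) e(2) qd by (intro mono_t) (simp_all add: b mdeg_add)
    from M_diff[OF p(2) this]
    have "yz_mono a b - ym (a + b - ex p) * pz p \<in> M"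
      unfolding b yz_mono_add_y yz_mono_add_z by (simp add: algebra_simps)
    with p(1) show ?thesis by blast
  qed
qed

text \<open>One representative with a single z for each commutative monomial; in degree r + 2 the
  choice of the letter is immaterial modulo \<open>M\<close>.\<close>

definition normal :: "(nat \<Rightarrow>\<^sub>0 nat) \<Rightarrow> 'a yzpoly" where
  "normal c = (let q = SOME q. q \<in> Poly_Mapping.keys c in ym (c - ex q) * pz q)"

lemma mono_normal_eq:
  assumes ab: "(a, b) \<in> exps d" "mdeg a + mdeg b = Suc (Suc r)"
  shows "yz_mono a b - normal (a + b) \<in> M"
proof -
  obtain p where p: "p \<in> Poly_Mapping.keys (a + b)" "yz_mono a b - ym (a + b - ex p) * pz p \<in> M"
    using mono_normal[OF assms] by blast
  define q where "q = (SOME q. q \<in> Poly_Mapping.keys (a + b))"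
  have q: "q \<in> Poly_Mapping.keys (a + b)"
    unfolding q_def using p(1) by (rule someI)
  have kd: "Poly_Mapping.keys (a + b) \<subseteq> {1..d}"
    using ab(1) by (simp add: exps_def keys_add_nat)
  \<comment> \<open>Two choices of the letter carried by z differ by a monomial times
    \<open>br q p\<close>.\<close>
  have "ym (a + b - ex p) * pz p - ym (a + b - ex q) * pz q \<in> M"
  proof (cases "p = q")
    case False
    obtain c where c: "a + b = c + ex p" using p(1) by (rule exponent_split)
    have "q \<in> Poly_Mapping.keys c" using q False by (simp add: c keys_add_nat)
    then obtain c' where c': "c = c' + ex q" by (rule exponent_split)
    have e: "a + b - ex p = c' + ex q" "a + b - ex q = c' + ex p"
      unfolding c c' by (auto intro!: poly_mapping_eqI simp: lookup_add lookup_minus)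
    have "ym c' * br q p \<in> M"
    proof (rule swap)
      have "mdeg (a + b) = mdeg c' + 2" unfolding c c' by (simp add: mdeg_add)
      then show "mdeg c' = r" using ab(2) by (simp add: mdeg_add)
      show "Poly_Mapping.keys c' \<subseteq> {1..d}" using kd unfolding c c' by (simp add: keys_add_nat)
    qed (use kd p q in auto)
    then show ?thesis unfolding e yz_mono_add_y by (simp add: algebra_simps)
  qed (simp add: M_0)
  from M_add[OF p(2) this] show ?thesis
    by (simp add: normal_def Let_def flip: q_def)
qed

text \<open>The linear map \<open>L\<close> from monomials to their normal representatives factors
  through symmetrization, so it kills \<open>h\<close>; and \<open>h - L h\<close> is a combination
  of the differences from \<open>mono_normal_eq\<close>.\<close>

lemma in_M_if_symmetrized_0:
  assumes h: "Poly_Mapping.keys h \<subseteq> exps d"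
    and deg: "Poly_Mapping.keys h \<subseteq> {m. mdeg (fst m) + mdeg (snd m) = Suc (Suc r)}"
    and zero: "subst_yz py py h = 0"
  shows "h \<in> M"
proof -
  define L where "L p = (\<Sum>m\<in>Poly_Mapping.keys p. Const (Poly_Mapping.lookup p m) * normal (fst m + snd m))"
    for p :: "'a yzpoly"
  have L_add: "L (p + q) = L p + L q" for p q
    unfolding L_def by (rule setsum_keys_plus_distrib) (simp_all add: Const_add distrib_right)
  have L_sum: "L (sum f S) = (\<Sum>s\<in>S. L (f s))" for f :: "'b \<Rightarrow> _" and S
    by (induct S rule: infinite_finite_induct) (simp_all add: L_add, simp_all add: L_def)
  have L_single: "L (Poly_Mapping.single m c) = Const c * normal (fst m + snd m)" for m c
    by (cases "c = 0") (simp_all add: L_def)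
  have evm: "evm py a = ym a" for a
    by (induct a rule: exponent_induct) (simp_all only: evm_0 evm_add evm_single yz_mono_0 yz_mono_add_y)
  have "subst_yz py py h = (\<Sum>m\<in>Poly_Mapping.keys h. Poly_Mapping.single (fst m + snd m, 0) (Poly_Mapping.lookup h m))"
    by (simp add: subst_alt evm yz_mono_def Const_def mult_single)
  \<comment> \<open>\<open>L\<close> sees a monomial only through the sum of its two exponents,
    which symmetrization preserves.\<close>
  then have "L (subst_yz py py h) = L h"
    by (simp add: L_sum L_single) (simp add: L_def)
  then have "L h = 0" by (simp add: zero L_def)
  moreover have "h - L h = (\<Sum>m\<in>Poly_Mapping.keys h. Const (Poly_Mapping.lookup h m) *
      (yz_mono (fst m) (snd m) - normal (fst m + snd m)))"
    by (simp add: L_def right_diff_distrib sum_subtractf yz_mono_decomp)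
  moreover have "\<dots> \<in> M"
    using h deg by (intro M_sum M_Const mono_normal_eq) auto
  ultimately show ?thesis by simp
qed

text \<open>\<open>polarize\<close> with \<open>F = 1\<close> yields all Y z_k, and
  \<open>mono_normal\<close> reduces every monomial to one of these.\<close>

lemma all_in_M:
  assumes start: "py 1 ^ Suc r * pz 1 \<in> M" and h: "Poly_Mapping.keys h \<subseteq> exps d"
    and deg: "Poly_Mapping.keys h \<subseteq> {m. mdeg (fst m) + mdeg (snd m) = Suc (Suc r)}"
  shows "h \<in> M"
proof -
  have yz: "ym a * pz k \<in> M" if "Poly_Mapping.keys a \<subseteq> {1..d}" "mdeg a = Suc r" "k \<in> {1..d}" for a k
  proof -
    have "ym a * pz k * 1 \<in> M"
      by (rule polarize[OF _ _ _ that]) (use start swap in \<open>auto simp: Der_1\<close>)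
    then show ?thesis by simp
  qed
  have mono: "yz_mono a b \<in> M" if ab: "(a, b) \<in> exps d" "mdeg a + mdeg b = Suc (Suc r)" for a b
  proof -
    obtain p where p: "p \<in> Poly_Mapping.keys (a + b)" "yz_mono a b - ym (a + b - ex p) * pz p \<in> M"
      using mono_normal[OF ab] by blast
    obtain c where c: "a + b = c + ex p" using p(1) by (rule exponent_split)
    have kd: "Poly_Mapping.keys (a + b) \<subseteq> {1..d}"
      using ab(1) by (simp add: exps_def keys_add_nat)
    have "ym c * pz p \<in> M"
    proof (rule yz)
      have "mdeg (a + b) = mdeg c + 1" unfolding c by (simp add: mdeg_add)
      then show "mdeg c = Suc r" using ab(2) by (simp add: mdeg_add)
    qed (use kd c in \<open>auto simp: keys_add_nat\<close>)
    moreover have "a + b - ex p = c" unfolding c by simp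
    ultimately have "ym (a + b - ex p) * pz p \<in> M" by simp
    from M_add[OF p(2) this] show ?thesis by simp
  qed
  have "(\<Sum>m\<in>Poly_Mapping.keys h. Const (Poly_Mapping.lookup h m) * yz_mono (fst m) (snd m)) \<in> M"
    using h deg by (intro M_sum M_Const mono) auto
  then show ?thesis by (simp only: yz_mono_decomp)
qed

end

section \<open>The T-ideal of the variety\<close>

lemma pol_0: "pol 0 = 0"
  by (simp add: pol_def zero_prod_def)

lemma poly_subspaceI:
  assumes "is_subspace (G_alg d) T" shows "poly_subspace {p. pol p \<in> T}"
proof
  note * = assms[unfolded is_subspace_def G_alg_simps]
  show "0 \<in> {p. pol p \<in> T}" using * by (simp add: pol_0)
  show "p + q \<in> {p. pol p \<in> T}" if "p \<in> {p. pol p \<in> T}" "q \<in> {p. pol p \<in> T}" for p q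
    using * that by (simp flip: pol_add)
  show "Const c * p \<in> {p. pol p \<in> T}" if "p \<in> {p. pol p \<in> T}" for p c
    using * that by (simp flip: gscale_pol)
qed

lemma ideal_py_mult:
  assumes "is_ideal (G_alg d) T" "pol p \<in> T" "i \<in> {1..d}"
  shows "pol (py i * p) \<in> T"
  using is_idealD(5)[OF assms(1), of "gx i" "pol p"] assms(2) gx_in_Gcarr[OF assms(3)]
  by (simp add: gmult_gYZ)

lemma ideal_pz_mult:
  assumes "is_ideal (G_alg d) T" "pol p \<in> T" "i \<in> {1..d}"
  shows "pol (pz i * p) \<in> T"
  using is_idealD(6)[OF assms(1), of "gx i" "pol p"] assms(2) gx_in_Gcarr[OF assms(3)]
  by (simp add: gmult_gYZ mult.commute)

text \<open>Left products with x_i multiply by y_i and right products by z_i, so even monomials in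
  the y_i alone or in the z_i alone, which are not in \<open>G_alg d\<close>, may be used as
  multipliers.\<close>

lemma ideal_mono_mult:
  assumes T: "is_ideal (G_alg d) T" "pol p \<in> T" and a: "Poly_Mapping.keys a \<subseteq> {1..d}" and b: "Poly_Mapping.keys b \<subseteq> {1..d}"
  shows "pol (yz_mono a b * p) \<in> T"
proof -
  have y: "pol (ym a * p) \<in> T"
    using a
  proof (induct a rule: exponent_induct)
    case zero
    then show ?case using T(2) by (simp add: yz_mono_0)
  next
    case (add a i)
    then have "pol (py i * (ym a * p)) \<in> T"
      by (intro ideal_py_mult[OF T(1)]) (auto simp: keys_add_nat)
    then show ?case unfolding yz_mono_add_y by (simp add: ac_simps)
  qed
  show ?thesis
    using b
  proof (induct b rule: exponent_induct)
    case zero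
    then show ?case using y by simp
  next
    case (add b i)
    then have "pol (pz i * (yz_mono a b * p)) \<in> T"
      by (intro ideal_pz_mult[OF T(1)]) (auto simp: keys_add_nat)
    then show ?case unfolding yz_mono_add_z by (simp add: ac_simps)
  qed
qed

context
  fixes d :: nat and \<beta>1 \<beta>2 :: "'k::field_char_0"
  assumes d: "2 \<le> d" and b_nz: "(\<beta>1, \<beta>2) \<noteq> (0, 0)" and b_sum: "\<beta>1 + \<beta>2 = 0"
begin

abbreviation "V \<equiv> V_ideal d (\<beta>1, \<beta>2)"

lemmas V_T_ideal = is_T_ideal_V_ideal[OF d, of "(\<beta>1, \<beta>2)"]
lemmas V_is_ideal = is_T_idealD(1)[OF V_T_ideal]

lemma poly_subspace_V: "poly_subspace {p. pol p \<in> V}"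
  using V_is_ideal by (intro poly_subspaceI[of d]) (simp add: is_ideal_def)

text \<open>As \<beta>2 = - \<beta>1 with \<beta>1 nonzero, the generator can be scaled to
  \<open>tt 1 * br 1 2\<close>; then \<open>w\<close> is substituted for x_1 and \<open>w'\<close>
  for x_2.\<close>

lemma V_subst:
  assumes "w \<in> Gcarr d" "w' \<in> Gcarr d"
  shows "pol ((gY w - gZ w) * (gY w * gZ w' - gY w' * gZ w)) \<in> V"
proof -
  interpret poly_subspace "{p. pol p \<in> V}" by (rule poly_subspace_V)
  have b2: "\<beta>2 = - \<beta>1" and b1: "\<beta>1 \<noteq> 0"
    using b_sum b_nz by (auto simp: eq_neg_iff_add_eq_0 add.commute)
  have "pol ((Const \<beta>1 * py 1 + Const \<beta>2 * pz 1) * br 1 2) \<in> V"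
    using T_ideal_incl[of _ "G_alg d"] unfolding V_ideal_def by fastforce
  then have "Const \<beta>1 * (tt 1 * br 1 2) \<in> {p. pol p \<in> V}"
    by (simp add: b2 Const_uminus algebra_simps)
  then have gen: "pol (tt 1 * br 1 2) \<in> V"
    using M_cancel_Const[of \<beta>1] b1 by blast
  have "gsub (\<lambda>i. if i = 1 then w else w') \<in> endos (G_alg d)"
    using assms by (intro gsub_in_endos) simp
  from is_T_idealD(2)[OF V_T_ideal this gen] show ?thesis
    by (simp add: gsub_pol subst_mult subst_diff)
qed

lemma V_rel1:
  assumes i: "i \<in> {1..d}" and j: "j \<in> {1..d}" and k: "k \<in> {1..d}"
  shows "pol (tt k * br i j) \<in> V"
proof -
  interpret poly_subspace "{p. pol p \<in> V}" by (rule poly_subspace_V)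
  have sq: "tt k * br k j \<in> {p. pol p \<in> V}" if "j \<in> {1..d}" "k \<in> {1..d}" for j k
    using V_subst[OF gx_in_Gcarr[OF that(2)] gx_in_Gcarr[OF that(1)]] by simp
  \<comment> \<open>Linearization: x_k + x_i is substituted for x_1, and the two pure terms are
    subtracted.\<close>
  have A: "tt k * br i j + tt i * br k j \<in> {p. pol p \<in> V}"
    if "i \<in> {1..d}" "j \<in> {1..d}" "k \<in> {1..d}" for i j k
  proof -
    have "(tt k + tt i) * (br k j + br i j) \<in> {p. pol p \<in> V}"
      using V_subst[OF Gcarr_add[OF gx_in_Gcarr[OF that(3)] gx_in_Gcarr[OF that(1)]] gx_in_Gcarr[OF that(2)]]
      by (simp add: algebra_simps)
    from M_diff[OF M_diff[OF this sq[OF that(2,3)]] sq[OF that(2,1)]] show ?thesis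
      by (simp add: algebra_simps)
  qed
  \<comment> \<open>The cyclic sum of \<open>tt k * br i j\<close> vanishes identically, so the
    difference of the two linearizations is 3 times the wanted element.\<close>
  have "of_nat (Suc 2) * (tt k * br i j) \<in> {p. pol p \<in> V}"
    using M_diff[OF A[OF i j k] A[OF j i k]] by (simp add: algebra_simps)
  then have "tt k * br i j \<in> {p. pol p \<in> V}" by (rule M_cancel_of_nat)
  then show ?thesis by simp
qed

lemma V_rel2:
  assumes ab: "(a, b) \<in> exps d" and i: "i \<in> {1..d}" and j: "j \<in> {1..d}"
  shows "pol (yz_mono a b * (tt i * tt j)) \<in> V"
proof -
  interpret poly_subspace "{p. pol p \<in> V}" by (rule poly_subspace_V)
  from ab have "a \<noteq> 0" "b \<noteq> 0" by (auto simp: exps_def)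
  then obtain p q where "p \<in> Poly_Mapping.keys a" "q \<in> Poly_Mapping.keys b" by fastforce
  then obtain a' b' where a': "a = a' + ex p" and b': "b = b' + ex q"
    by (metis exponent_split)
  have pq: "p \<in> {1..d}" "q \<in> {1..d}" and keys: "Poly_Mapping.keys a' \<subseteq> {1..d}" "Poly_Mapping.keys b' \<subseteq> {1..d}"
    using ab by (auto simp: exps_def a' b' keys_add_nat)
  let ?u = "py p * pz q"
  \<comment> \<open>For \<open>w'\<close> equal to the product of x_p and x_q, both readings of
    \<open>w'\<close> are \<open>?u\<close>, and the bracket in \<open>V_subst\<close> becomes
    \<open>?u * tt i\<close>.\<close>
  have sq: "?u * (tt i * tt i) \<in> {p. pol p \<in> V}" if "i \<in> {1..d}" for i
    using V_subst[OF gx_in_Gcarr[OF that] py_pz_in_Gcarr[OF pq]] by (simp add: algebra_simps)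
  have "?u * ((tt i + tt j) * (tt i + tt j)) \<in> {p. pol p \<in> V}"
    using V_subst[OF Gcarr_add[OF gx_in_Gcarr[OF i] gx_in_Gcarr[OF j]] py_pz_in_Gcarr[OF pq]]
    by (simp add: algebra_simps)
  from M_diff[OF M_diff[OF this sq[OF i]] sq[OF j]]
  have "of_nat (Suc 1) * (?u * (tt i * tt j)) \<in> {p. pol p \<in> V}"
    by (simp add: algebra_simps)
  then have "?u * (tt i * tt j) \<in> {p. pol p \<in> V}" by (rule M_cancel_of_nat)
  then have "pol (yz_mono a' b' * (?u * (tt i * tt j))) \<in> V"
    using keys by (intro ideal_mono_mult[OF V_is_ideal]) simp_all
  then show ?thesis unfolding a' b' yz_mono_add_y yz_mono_add_z by (simp add: ac_simps)
qed

lemma V_subspaceI: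
  assumes sub: "is_subspace (G_alg d) T" and gl: "\<And>g p. g \<in> GL d \<Longrightarrow> p \<in> T \<Longrightarrow> gl_act d g p \<in> T"
    and V: "V \<subseteq> T"
  shows "V_subspace {p. pol p \<in> T} d"
proof -
  interpret poly_subspace "{p. pol p \<in> T}" by (rule poly_subspaceI[OF sub])
  show ?thesis
  proof
    show "2 \<le> d" by (rule d)
    fix g :: "'k mat" and p assume "g \<in> GL d" "p \<in> {p. pol p \<in> T}"
    then show "subst_yz (gy d g) (gz d g) p \<in> {p. pol p \<in> T}"
      using gl[of g "pol p"] by (simp add: pol_def gl_act_alt gv_def)
  next
    fix a :: "nat \<Rightarrow>\<^sub>0 nat" and i j k
    assume "Poly_Mapping.keys a \<subseteq> {1..d}" "i \<in> {1..d}" "j \<in> {1..d}" "k \<in> {1..d}"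
    then have "pol (ym a * (tt k * br i j)) \<in> V"
      by (intro ideal_mono_mult[OF V_is_ideal] V_rel1) simp_all
    then show "ym a * (tt k * br i j) \<in> {p. pol p \<in> T}" using V by blast
  next
    fix a b :: "nat \<Rightarrow>\<^sub>0 nat" and i j
    assume "(a, b) \<in> exps d" "i \<in> {1..d}" "j \<in> {1..d}"
    then show "yz_mono a b * (tt i * tt j) \<in> {p. pol p \<in> T}" using V V_rel2 by blast
  qed
qed

lemma V_subspace_T_ideal:
  assumes "is_T_ideal (G_alg d) T" "V \<subseteq> T"
  shows "V_subspace {p. pol p \<in> T} d"
  using assms(2) is_T_idealD(2)[OF assms(1) gl_act_in_endos] is_T_idealD(1)[OF assms(1)]
  by (intro V_subspaceI) (simp_all add: is_ideal_def)

section \<open>Generating a whole component or its symmetrization kernel\<close>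

lemma Ghom_pol:
  assumes "h \<in> Ghom d m" "2 \<le> m"
  shows "h = pol (snd h)" "Poly_Mapping.keys (snd h) \<subseteq> exps d"
    "Poly_Mapping.keys (snd h) \<subseteq> {e. mdeg (fst e) + mdeg (snd e) = m}"
  using assms by (auto simp: Ghom_iff Gcarr_iff pol_def prod_eq_iff)

context
  fixes T :: "'k gelem set"
  assumes sub: "is_subspace (G_alg d) T" and gl: "\<And>g p. g \<in> GL d \<Longrightarrow> p \<in> T \<Longrightarrow> gl_act d g p \<in> T"
    and V: "V \<subseteq> T"
begin

interpretation V_subspace "{p. pol p \<in> T}" d by (rule V_subspaceI[OF sub gl V])

lemma W_subspaceI:
  assumes "pol (py 1 ^ Suc r * pz 1 * tt 1) \<in> T" "pol (py 1 ^ Suc r * br 1 2) \<in> T"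
  shows "W_subspace {p. pol p \<in> T} d (Suc r)"
  by unfold_locales (use all_W[of r] assms in simp)

lemma kernel_component:
  assumes L: "pol (py 1 ^ Suc r * pz 1 * tt 1) \<in> T" "pol (py 1 ^ Suc r * br 1 2) \<in> T"
    and h: "h \<in> Ghom d (r + 3)" "h \<in> sym_kernel d"
  shows "h \<in> T"
proof -
  \<comment> \<open>The parameter of \<open>W_subspace\<close> is the degree minus 2, and the degree
    is r + 3.\<close>
  interpret W_subspace "{p. pol p \<in> T}" d "Suc r" by (rule W_subspaceI[OF L])
  note hp = Ghom_pol[OF h(1), simplified]
  have "subst_yz py py (snd h) = 0"
    using h(2) gY_pol[of "snd h"] unfolding hp(1)[symmetric] by (simp add: sym_kernel_def)
  then have "snd h \<in> {p. pol p \<in> T}"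
    using hp(2,3) by (intro in_M_if_symmetrized_0) (simp_all add: numeral_3_eq_3)
  then have "pol (snd h) \<in> T" by simp
  then show ?thesis by (simp only: hp(1)[symmetric])
qed

lemma full_component:
  assumes L: "pol (py 1 ^ Suc (Suc r) * pz 1) \<in> T" "pol (py 1 ^ Suc r * pz 1 ^ 2) \<in> T" "pol (py 1 ^ Suc r * br 1 2) \<in> T"
    and h: "h \<in> Ghom d (r + 3)"
  shows "h \<in> T"
proof -
  have "py 1 ^ Suc (Suc r) * pz 1 - py 1 ^ Suc r * pz 1 ^ 2 \<in> {p. pol p \<in> T}"
    using L by (intro M_diff) simp_all
  then have "pol (py 1 ^ Suc r * pz 1 * tt 1) \<in> T"
    by (simp add: algebra_simps power2_eq_square)
  then interpret W_subspace "{p. pol p \<in> T}" d "Suc r" using L(3) by (rule W_subspaceI)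
  note hp = Ghom_pol[OF h, simplified]
  have "snd h \<in> {p. pol p \<in> T}"
    using hp(2,3) L(1) by - (rule all_in_M, simp_all add: numeral_3_eq_3)
  then have "pol (snd h) \<in> T" by simp
  then show ?thesis by (simp only: hp(1)[symmetric])
qed

text \<open>The identities of the variety start in degree 3, so degree 2 uses derivations alone:
  \<open>br 1 2\<close> gives \<open>br 1 k\<close>, \<open>py 1 * pz 1\<close> gives
  \<open>py 1 * pz k + py k * pz 1\<close>, their sum is twice \<open>py 1 * pz k\<close>, and 1 ->
  j gives the remaining products.\<close>

lemma quadratic_component:
  assumes L: "pol (py 1 * pz 1) \<in> T" "pol (br 1 2) \<in> T" and h: "h \<in> Ghom d 2"
  shows "h \<in> T"
proof -
  let ?M = "{p. pol p \<in> T}"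
  have br: "br 1 k \<in> ?M" if k: "k \<in> {1..d}" for k
  proof (cases "k = 2")
    case False
    then have "2 \<noteq> k" by simp
    note i = one_two(2) k this
    have "Der d 2 k (br 1 2) ((py 1 * (if 2 = (2::nat) then pz k else 0) + (if 1 = (2::nat) then py k else 0) * pz 2) -
      (py 2 * (if 1 = (2::nat) then pz k else 0) + (if 2 = (2::nat) then py k else 0) * pz 1))"
      by (intro Der_diff Der_mult Der_py Der_pz i one_two)
    from M_Der[OF this _ i] L(2) show ?thesis by simp
  qed (use L in simp)
  have y1: "py 1 * pz k \<in> ?M" if k: "k \<in> {1..d}" for k
  proof (cases "k = 1")
    case False
    then have "1 \<noteq> k" by simp
    note i = one_two(1) k this
    have "Der d 1 k (py 1 * pz 1) (py 1 * (if 1 = (1::nat) then pz k else 0) + (if 1 = (1::nat) then py k else 0) * pz 1)"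
      by (intro Der_mult Der_py Der_pz i)
    from M_Der[OF this _ i] L(1) have "py 1 * pz k + py k * pz 1 \<in> ?M" by simp
    from M_add[OF this br[OF k]] have "of_nat (Suc 1) * (py 1 * pz k) \<in> ?M"
      by (simp add: algebra_simps)
    then show ?thesis by (rule M_cancel_of_nat)
  qed (use L in simp)
  have all: "py j * pz k \<in> ?M" if j: "j \<in> {1..d}" and k: "k \<in> {1..d}" for j k
  proof (cases "j = 1")
    case False
    then have "1 \<noteq> j" by simp
    note i = one_two(1) j this
    have "Der d 1 j (py 1 * pz k) (py 1 * (if k = 1 then pz j else 0) + (if 1 = (1::nat) then py j else 0) * pz k)"
      by (intro Der_mult Der_py Der_pz i k)
    from M_Der[OF this y1[OF k] i] have "py 1 * (if k = 1 then pz j else 0) + py j * pz k \<in> ?M" by simp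
    moreover have "py 1 * (if k = 1 then pz j else 0) \<in> ?M" using y1[OF j] M_0 by simp
    ultimately have "py 1 * (if k = 1 then pz j else 0) + py j * pz k - py 1 * (if k = 1 then pz j else 0) \<in> ?M"
      by (rule M_diff)
    then show ?thesis by simp
  qed (use y1[OF k] in simp)
  have mono: "yz_mono a b \<in> ?M" if "(a, b) \<in> exps d" "mdeg a + mdeg b = 2" for a b
  proof -
    have "a \<noteq> 0" "b \<noteq> 0" using that(1) by (auto simp: exps_def)
    then obtain p q where "p \<in> Poly_Mapping.keys a" "q \<in> Poly_Mapping.keys b" by fastforce
    then obtain a' b' where a': "a = a' + ex p" and b': "b = b' + ex q"
      by (metis exponent_split)
    have "mdeg a' = 0" "mdeg b' = 0" using that(2) by (simp_all add: a' b' mdeg_add)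
    then have "a' = 0" "b' = 0" by (auto simp: mdeg_def in_keys_iff intro!: poly_mapping_eqI)
    then show ?thesis
      using all[of p q] that(1) yz_mono_add_y[of 0 p b, where ?'a = 'k] yz_mono_add_z[of 0 0 q, where ?'a = 'k]
      by (simp add: a' b' exps_def yz_mono_0 mult.commute)
  qed
  note hp = Ghom_pol[OF h, simplified]
  have "(\<Sum>m\<in>Poly_Mapping.keys (snd h). Const (Poly_Mapping.lookup (snd h) m) * yz_mono (fst m) (snd m)) \<in> ?M"
    using hp(2,3) by (intro M_sum M_Const mono) auto
  then have "pol (snd h) \<in> T" by (simp add: yz_mono_decomp)
  then show ?thesis by (simp only: hp(1)[symmetric])
qed

end

end

section \<open>The consequences\<close>

lemma subst_power: "subst_yz f g (p ^ n) = subst_yz f g p ^ n"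
  by (induct n) (simp_all add: subst_1 subst_mult)

lemma pol_in_Ghom:
  assumes "p \<in> PB d i j" "1 \<le> i" "1 \<le> j" "i + j = m"
  shows "pol p \<in> Ghom d m"
  using assms by (auto simp: Ghom_iff Gcarr_iff pol_def PB_def exps_def)

lemmas Ghom_subspace = is_subspace_Ghom[unfolded is_subspace_def G_alg_simps, THEN conjunct2, THEN conjunct2]
lemmas Ghom_add = Ghom_subspace[THEN conjunct1, rule_format]
lemmas Ghom_scale = Ghom_subspace[THEN conjunct2, rule_format]

lemma Ghom_diff: "f \<in> Ghom d m \<Longrightarrow> g \<in> Ghom d m \<Longrightarrow> f - g \<in> Ghom d m"
  using Ghom_add[of f d m "gscale (-1) g"] Ghom_scale[of g d m "-1"] by (simp add: gscale_minus)

lemma Ghom_sub_Gcarr: "f \<in> Ghom d m \<Longrightarrow> f \<in> Gcarr d"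
  by (simp add: Ghom_iff)

lemma w_row_in_Ghom:
  assumes "2 \<le> d" "1 \<le> j" "j < m" shows "w_row m j \<in> Ghom d m"
proof -
  have "(1::nat) \<in> {1..d}" using assms by simp
  then have "py 1 ^ j * pz 1 ^ (m - j) \<in> PB d (j * 1 + (m - j) * 0) (j * 0 + (m - j) * 1)"
    by (intro PB_mult PB_pow PB_py PB_pz)
  then show ?thesis unfolding w_row_def by (rule pol_in_Ghom) (use assms in simp_all)
qed

text \<open>The upper index \<open>n\<close> is the largest admissible one, which makes the exponent
  of z_1 equal to 0.\<close>

lemma w_two_eq: "w_two (Suc n) 1 n = pol (py 1 ^ n * br 1 2)"
  by (simp add: w_two_def)

lemma w_two_in_Ghom:
  assumes "2 \<le> d" shows "w_two (Suc n) 1 n \<in> Ghom d (n + 2)"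
proof -
  have i: "(1::nat) \<in> {1..d}" "2 \<in> {1..d}" using assms by simp_all
  have "pol (py 1 ^ n * (py 1 * pz 2)) \<in> Ghom d (n + 2)" "pol (py 1 ^ n * (py 2 * pz 1)) \<in> Ghom d (n + 2)"
    using PB_mult[OF PB_pow[OF PB_py[OF i(1)], of n] PB_mult[OF PB_py[OF i(1)] PB_pz[OF i(2)]]]
      PB_mult[OF PB_pow[OF PB_py[OF i(1)], of n] PB_mult[OF PB_py[OF i(2)] PB_pz[OF i(1)]]]
    by (auto elim!: pol_in_Ghom)
  from Ghom_diff[OF this] show ?thesis
    unfolding w_two_eq by (simp add: pol_diff algebra_simps)
qed

lemma w_row_Suc: "w_row (Suc n) n = pol (py 1 ^ n * pz 1)"
  by (simp add: w_row_def)

lemma w_row_Suc_Suc: "w_row (Suc (Suc n)) n = pol (py 1 ^ n * pz 1 ^ 2)"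
  by (simp add: w_row_def numeral_2_eq_2)

lemma w_row_diff: "w_row (Suc (Suc n)) (Suc n) - w_row (Suc (Suc n)) n = pol (py 1 ^ n * pz 1 * tt 1)"
  by (simp add: w_row_Suc w_row_Suc_Suc pol_diff algebra_simps power2_eq_square)

text \<open>The difference is the commutator of \<open>gx 1\<close> and
  \<open>w_row (Suc (Suc n)) (Suc n)\<close>.\<close>

lemma w_row_diff_in_commutator_ideal:
  assumes "2 \<le> d"
  shows "w_row (Suc (Suc (Suc n))) (Suc (Suc n)) - w_row (Suc (Suc (Suc n))) (Suc n) \<in> commutator_ideal (G_alg d)"
proof -
  let ?P = "w_row (Suc (Suc n)) (Suc n)"
  have "gx 1 \<in> Gcarr d" "?P \<in> Gcarr d"
    using assms by (simp_all add: gx_in_Gcarr Ghom_sub_Gcarr[OF w_row_in_Ghom])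
  then have "gmult (gx 1) ?P + gscale (-1) (gmult ?P (gx 1)) \<in> commutators (G_alg d)"
    unfolding commutators_def G_alg_simps by blast
  also have "gmult (gx 1) ?P + gscale (-1) (gmult ?P (gx 1)) =
      w_row (Suc (Suc (Suc n))) (Suc (Suc n)) - w_row (Suc (Suc (Suc n))) (Suc n)"
    unfolding w_row_diff by (simp add: w_row_Suc gmult_gYZ pol_add Const_uminus algebra_simps)
  finally show ?thesis by (rule subsetD[OF commutators_in_ideal])
qed

text \<open>\<open>br 1 2\<close> is the commutator of \<open>gx 1\<close> and \<open>gx 2\<close>,
  and left multiplication by \<open>gx 1\<close> supplies the powers of y_1.\<close>

lemma w_two_in_commutator_ideal:
  assumes "2 \<le> d"
  shows "(w_two (Suc n) 1 n :: 'k::field_char_0 gelem) \<in> commutator_ideal (G_alg d)"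
proof -
  have ideal: "is_ideal (G_alg d) (commutator_ideal (G_alg d :: ('k, _) nalg))"
    by (rule is_T_idealD[OF is_T_ideal_commutator_ideal]) (simp_all add: is_ideal_Gcarr)
  have i: "(1::nat) \<in> {1..d}" "2 \<in> {1..d}" using assms by simp_all
  have "gmult (gx 1) (gx 2) + gscale (-1) (gmult (gx 2) (gx 1)) \<in> commutators (G_alg d :: ('k, _) nalg)"
    using gx_in_Gcarr[OF i(1)] gx_in_Gcarr[OF i(2)] unfolding commutators_def G_alg_simps by blast
  then have "gmult (gx 1) (gx 2) + gscale (-1) (gmult (gx 2) (gx 1)) \<in> commutator_ideal (G_alg d :: ('k, _) nalg)"
    by (rule subsetD[OF commutators_in_ideal])
  then have "pol (br 1 2) \<in> commutator_ideal (G_alg d :: ('k, _) nalg)"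
    by (simp add: gmult_gYZ pol_add Const_uminus)
  from ideal_mono_mult[OF ideal this, of "Poly_Mapping.single 1 n" 0] i(1) show ?thesis
    unfolding w_two_eq by (simp add: yz_mono_pow)
qed

section \<open>Lower bounds: elements forced into a T-ideal by a given polynomial\<close>

context
  fixes d :: nat and \<beta>1 \<beta>2 :: "'k::field_char_0" and T :: "'k gelem set"
  assumes d: "2 \<le> d" and b_nz: "(\<beta>1, \<beta>2) \<noteq> (0, 0)" and b_sum: "\<beta>1 + \<beta>2 = 0"
    and T: "is_T_ideal (G_alg d) T" and V: "V_ideal d (\<beta>1, \<beta>2) \<subseteq> T"
begin

interpretation V_subspace "{p. pol p \<in> T}" d
  by (rule V_subspace_T_ideal[OF d b_nz b_sum T V])

lemmas py_mult = ideal_py_mult[OF is_T_idealD(1)[OF T]]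
lemmas pz_mult = ideal_pz_mult[OF is_T_idealD(1)[OF T]]

lemma T_linear_lower:
  assumes "gx 1 \<in> T"
  shows "pol (py 1 * pz 1) \<in> T" "pol (br 1 2) \<in> T"
proof -
  note m = is_idealD(5,6)[OF is_T_idealD(1)[OF T], unfolded G_alg_simps, OF gx_in_Gcarr assms]
  have "py 1 * pz 1 \<in> {p. pol p \<in> T}" "py 1 * pz 2 \<in> {p. pol p \<in> T}" "py 2 * pz 1 \<in> {p. pol p \<in> T}"
    using m[OF one_two(1)] m[OF one_two(2)] by (simp_all add: gmult_gYZ)
  then show "pol (py 1 * pz 1) \<in> T" "pol (br 1 2) \<in> T"
    using M_diff[of "py 1 * pz 2" "py 2 * pz 1"] by simp_all
qed

lemma T_quadratic_lower:
  assumes f: "pol (py 1 * pz 1) \<in> T"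
  shows "pol (py 1 ^ 2 * pz 1) \<in> T" "pol (py 1 * pz 1 ^ 2) \<in> T" "pol (py 1 * br 1 2) \<in> T"
proof -
  note i = one_two
  show "pol (py 1 ^ 2 * pz 1) \<in> T" "pol (py 1 * pz 1 ^ 2) \<in> T"
    using py_mult[OF f i(1)] pz_mult[OF f i(1)] by (simp_all add: power2_eq_square ac_simps)
  have "Der d 1 2 (py 1 * pz 1) (py 1 * (if 1 = (1::nat) then pz 2 else 0) + (if 1 = (1::nat) then py 2 else 0) * pz 1)"
    by (intro Der_mult Der_py Der_pz i) simp_all
  from M_Der[OF this _ i] f have "pol (py 1 * pz 2 + py 2 * pz 1) \<in> T" by simp
  then have A: "py 1 * (py 1 * pz 2 + py 2 * pz 1) \<in> {p. pol p \<in> T}"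
    using py_mult[OF _ i(1)] by simp
  have B: "of_nat 2 * (py 2 * (py 1 * pz 1)) \<in> {p. pol p \<in> T}"
    using py_mult[OF f i(2)] by (intro M_of_nat) simp
  \<comment> \<open>Here y_1 (y_1 z_2 + y_2 z_1) - 2 y_2 y_1 z_1 = y_1 (y_1 z_2 - y_2 z_1).\<close>
  from M_diff[OF A B] show "pol (py 1 * br 1 2) \<in> T"
    by (simp add: algebra_simps)
qed

lemma T_rel2:
  assumes "1 \<le> r" "i \<in> {1..d}"
  shows "pol (py 1 ^ r * pz 1 * (tt 1 * tt i)) \<in> T"
proof -
  have "(Poly_Mapping.single 1 r, ex 1) \<in> exps d"
    using assms d by (simp add: exps_def)
  from rel2[OF this one_two(1) assms(2)]
  show ?thesis
    using yz_mono_add_z[of "Poly_Mapping.single 1 r" 0 1, where ?'a = 'k] by (simp add: yz_mono_pow)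
qed

lemma T_row_diff_lower:
  assumes f: "pol (py 1 ^ Suc r * pz 1 * tt 1) \<in> T"
  shows "pol (py 1 ^ Suc (Suc r) * pz 1 * tt 1) \<in> T" "pol (py 1 ^ Suc (Suc r) * br 1 2) \<in> T"
proof -
  show "pol (py 1 ^ Suc (Suc r) * pz 1 * tt 1) \<in> T"
    using py_mult[OF f one_two(1)] by (simp add: ac_simps)
  have "pol (of_nat (Suc (Suc r)) * (py 1 ^ Suc r * pz 2 * tt 1) + py 1 ^ Suc r * pz 1 * tt 2) \<in> T"
    using y1_power_t[of r] f by simp
  then have A: "py 1 * (of_nat (Suc (Suc r)) * (py 1 ^ Suc r * pz 2 * tt 1) + py 1 ^ Suc r * pz 1 * tt 2) \<in> {p. pol p \<in> T}"
    using py_mult[OF _ one_two(1)] by simp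
  have B: "py 2 * (py 1 ^ Suc r * pz 1 * tt 1) \<in> {p. pol p \<in> T}"
    using py_mult[OF f one_two(2)] by simp
  have C: "py 1 ^ Suc r * (tt 1 * br 1 2) \<in> {p. pol p \<in> T}"
    using rel1[of "Poly_Mapping.single 1 (Suc r)" 1 2 1] one_two by (simp add: yz_mono_pow)
  \<comment> \<open>The sum of \<open>B\<close> and \<open>C\<close> is
    \<open>py 1 ^ Suc (Suc r) * pz 2 * tt 1\<close>. The factor r + 3 exceeds the coefficient in
    \<open>A\<close> by 1, so subtracting \<open>A\<close> leaves the power of y_1 times
    \<open>pz 2 * tt 1 - pz 1 * tt 2\<close>, which is \<open>br 1 2\<close>.\<close>
  have D: "of_nat (Suc (Suc (Suc r))) * (py 2 * (py 1 ^ Suc r * pz 1 * tt 1) + py 1 ^ Suc r * (tt 1 * br 1 2)) \<in> {p. pol p \<in> T}"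
    by (intro M_of_nat M_add B C)
  from M_diff[OF D A] show "pol (py 1 ^ Suc (Suc r) * br 1 2) \<in> T"
    by (simp add: algebra_simps)
qed

text \<open>The first summand survives symmetrization, the second is a multiple of
  \<open>tt 1\<close>. One more factor \<open>tt i\<close> kills the second modulo
  \<open>rel2\<close>, which separates the two.\<close>

lemma T_row_lower:
  assumes f: "pol (Const c * (py 1 ^ Suc (Suc r) * pz 1) - Const c' * (py 1 ^ Suc r * pz 1 * tt 1)) \<in> T" and c: "c \<noteq> 0"
  shows "pol (py 1 ^ Suc (Suc (Suc r)) * pz 1) \<in> T" "pol (py 1 ^ Suc (Suc r) * pz 1 ^ 2) \<in> T"
    "pol (py 1 ^ Suc (Suc r) * br 1 2) \<in> T"
proof -
  let ?f = "Const c * (py 1 ^ Suc (Suc r) * pz 1) - Const c' * (py 1 ^ Suc r * pz 1 * tt 1)"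
  have t: "py 1 ^ Suc (Suc r) * pz 1 * tt i \<in> {p. pol p \<in> T}" if i: "i \<in> {1..d}" for i
  proof -
    have "py i * ?f \<in> {p. pol p \<in> T}" "pz i * ?f \<in> {p. pol p \<in> T}"
      using py_mult[OF f i] pz_mult[OF f i] by simp_all
    \<comment> \<open>Left minus right multiplication by x_i is multiplication by
      \<open>tt i\<close>.\<close>
    from M_diff[OF this] have A: "?f * tt i \<in> {p. pol p \<in> T}"
      by (simp add: algebra_simps)
    have "Const c' * (py 1 ^ Suc r * pz 1 * (tt 1 * tt i)) \<in> {p. pol p \<in> T}"
      using T_rel2[of "Suc r", OF _ i] by (intro M_Const) simp
    from M_add[OF A this] have "Const c * (py 1 ^ Suc (Suc r) * pz 1 * tt i) \<in> {p. pol p \<in> T}"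
      by (simp add: algebra_simps)
    then show ?thesis using c by (rule M_cancel_Const)
  qed
  have "py 1 * ?f \<in> {p. pol p \<in> T}" using py_mult[OF f one_two(1)] by simp
  from M_add[OF this M_Const[OF t[OF one_two(1)], of c']]
  have "Const c * (py 1 ^ Suc (Suc (Suc r)) * pz 1) \<in> {p. pol p \<in> T}"
    by (simp add: algebra_simps)
  then have A: "py 1 ^ Suc (Suc (Suc r)) * pz 1 \<in> {p. pol p \<in> T}"
    using c by (rule M_cancel_Const)
  then show "pol (py 1 ^ Suc (Suc (Suc r)) * pz 1) \<in> T" by simp
  from M_diff[OF A t[OF one_two(1)]] show "pol (py 1 ^ Suc (Suc r) * pz 1 ^ 2) \<in> T"
    by (simp add: algebra_simps power2_eq_square)
  have "of_nat (Suc (Suc (Suc r))) * (py 1 ^ Suc (Suc r) * pz 2 * tt 1) + py 1 ^ Suc (Suc r) * pz 1 * tt 2 \<in> {p. pol p \<in> T}"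
    by (rule y1_power_t[OF t[OF one_two(1)]])
  from M_diff[OF this t[OF one_two(2)]]
  have "of_nat (Suc (Suc (Suc r))) * (py 1 ^ Suc (Suc r) * pz 2 * tt 1) \<in> {p. pol p \<in> T}" by simp
  then have "py 1 ^ Suc (Suc r) * pz 2 * tt 1 \<in> {p. pol p \<in> T}" by (rule M_cancel_of_nat)
  \<comment> \<open>Again \<open>pz 2 * tt 1 - pz 1 * tt 2 = br 1 2\<close>.\<close>
  from M_diff[OF this t[OF one_two(2)]] show "pol (py 1 ^ Suc (Suc r) * br 1 2) \<in> T"
    by (simp add: algebra_simps)
qed

lemma T_two_lower:
  assumes f: "pol (py 1 ^ Suc r * br 1 2) \<in> T"
  shows "pol (py 1 ^ Suc r * pz 1 ^ 2 * tt 1) \<in> T" "pol (py 1 ^ Suc (Suc r) * br 1 2) \<in> T"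
proof -
  show "pol (py 1 ^ Suc (Suc r) * br 1 2) \<in> T"
    using py_mult[OF f one_two(1)] by (simp add: ac_simps)
  \<comment> \<open>Substituting the square of x_1 for x_2 turns \<open>br 1 2\<close> into
    \<open>py 1 * pz 1 * tt 1\<close>.\<close>
  have "gsub (\<lambda>i. if i = 2 then pol (py 1 * pz 1) else gx i) \<in> endos (G_alg d)"
    using d by (intro gsub_in_endos) (auto intro!: gx_in_Gcarr py_pz_in_Gcarr)
  from is_T_idealD(2)[OF T this f]
  have A: "py 1 ^ Suc (Suc r) * pz 1 * tt 1 \<in> {p. pol p \<in> T}"
    by (simp add: gsub_pol subst_mult subst_diff subst_power algebra_simps)
  have "py 1 ^ Suc r * pz 1 * (tt 1 * tt 1) \<in> {p. pol p \<in> T}"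
    using T_rel2[of "Suc r", OF _ one_two(1)] by simp
  \<comment> \<open>The identity \<open>py 1 - tt 1 = pz 1\<close> exchanges a factor y_1 for
    z_1.\<close>
  from M_diff[OF A this] show "pol (py 1 ^ Suc r * pz 1 ^ 2 * tt 1) \<in> T"
    by (simp add: algebra_simps power2_eq_square)
qed

end

section \<open>The five cases\<close>

context
  fixes d :: nat and \<beta>1 \<beta>2 :: "'k::field_char_0"
  assumes d: "2 \<le> d" and b_nz: "(\<beta>1, \<beta>2) \<noteq> (0, 0)" and b_sum: "\<beta>1 + \<beta>2 = 0"
begin

lemma case_linear: "conseq_equiv d (\<beta>1, \<beta>2) 1 w_one {w_row 2 1, w_two 1 1 0}"
proof (rule conseq_equivI[where Q = "\<lambda>_. True"])
  have L: "w_row 2 1 = pol (py 1 * pz 1)" "w_two 1 1 0 = pol (br 1 2)"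
    by (simp_all add: w_row_def w_two_def)
  show "w_one \<in> Gcarr d"
    using d by (simp add: w_one_def gx_in_Gcarr)
  show "{w_row 2 1, w_two 1 1 0} \<subseteq> Ghom d (1 + 1)"
    using w_row_in_Ghom[OF d, of 1 2] w_two_in_Ghom[OF d, of 0] by (simp add: numeral_2_eq_2)
  show "{w_row 2 1, w_two 1 1 0} \<subseteq> T"
    if "is_T_ideal (G_alg d) T" "V_ideal d (\<beta>1, \<beta>2) \<subseteq> T" "w_one \<in> T" for T
    using T_linear_lower[OF d b_nz b_sum that(1,2)] that(3) unfolding w_one_def L by simp
  show "h \<in> M" if "is_subspace (G_alg d) M" "\<And>g p. g \<in> GL d \<Longrightarrow> p \<in> M \<Longrightarrow> gl_act d g p \<in> M"
    "V_ideal d (\<beta>1, \<beta>2) \<subseteq> M" "{w_row 2 1, w_two 1 1 0} \<subseteq> M" "h \<in> Ghom d (1 + 1)" for M h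
  proof (rule quadratic_component[OF d b_nz b_sum that(1,2,3)])
    show "h \<in> Ghom d 2" using that(5) by (simp add: numeral_2_eq_2)
  qed (use that(4) in \<open>simp_all add: L[unfolded One_nat_def]\<close>)
qed (use d in simp_all)

lemma case_quadratic: "conseq_equiv d (\<beta>1, \<beta>2) 2 (w_row 2 1) {w_row 3 2, w_row 3 1, w_two 2 1 1}"
proof (rule conseq_equivI[where Q = "\<lambda>_. True"])
  have L: "w_row 2 1 = pol (py 1 * pz 1)" "w_row 3 2 = pol (py 1 ^ 2 * pz 1)"
    "w_row 3 1 = pol (py 1 * pz 1 ^ 2)" "w_two 2 1 1 = pol (py 1 * br 1 2)"
    by (simp_all add: w_row_def w_two_def)
  show "w_row 2 1 \<in> Gcarr d"
    by (rule Ghom_sub_Gcarr, rule w_row_in_Ghom[OF d]) simp_all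
  show "{w_row 3 2, w_row 3 1, w_two 2 1 1} \<subseteq> Ghom d (2 + 1)"
    using w_row_in_Ghom[OF d, of 1 3] w_row_in_Ghom[OF d, of 2 3] w_two_in_Ghom[OF d, of 1]
    by (simp add: numeral_2_eq_2 numeral_3_eq_3)
  show "{w_row 3 2, w_row 3 1, w_two 2 1 1} \<subseteq> T"
    if "is_T_ideal (G_alg d) T" "V_ideal d (\<beta>1, \<beta>2) \<subseteq> T" "w_row 2 1 \<in> T" for T
    using T_quadratic_lower[OF d b_nz b_sum that(1,2)] that(3) unfolding L by simp
  show "h \<in> M" if "is_subspace (G_alg d) M" "\<And>g p. g \<in> GL d \<Longrightarrow> p \<in> M \<Longrightarrow> gl_act d g p \<in> M"
    "V_ideal d (\<beta>1, \<beta>2) \<subseteq> M" "{w_row 3 2, w_row 3 1, w_two 2 1 1} \<subseteq> M" "h \<in> Ghom d (2 + 1)" for M h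
  proof (rule full_component[OF d b_nz b_sum that(1,2,3), where r = 0])
    show "h \<in> Ghom d (0 + 3)" using that(5) by simp
  qed (use that(4) in \<open>simp_all add: L[unfolded One_nat_def] power2_eq_square\<close>)
qed (use d in simp_all)

lemma case_row:
  assumes n: "n = Suc (Suc (Suc s))" and c: "\<gamma>1 + \<gamma>2 \<noteq> 0"
  shows "conseq_equiv d (\<beta>1, \<beta>2) n (\<gamma>1 *\<^sub>G w_row n (n - 1) + \<gamma>2 *\<^sub>G w_row n (n - 2))
    {w_row (n + 1) n, w_row (n + 1) (n - 1), w_two n 1 (n - 1)}"
proof -
  let ?f = "\<gamma>1 *\<^sub>G w_row n (n - 1) + \<gamma>2 *\<^sub>G w_row n (n - 2)"
    and ?L = "{w_row (n + 1) n, w_row (n + 1) (n - 1), w_two n 1 (n - 1)} :: 'k gelem set"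
  \<comment> \<open>The coefficient of the first row polynomial becomes \<gamma>1 + \<gamma>2 after
    \<open>\<gamma>2\<close> times the difference of the two row polynomials is split off.\<close>
  have f: "?f = pol (Const (\<gamma>1 + \<gamma>2) * (py 1 ^ Suc (Suc s) * pz 1) - Const \<gamma>2 * (py 1 ^ Suc s * pz 1 * tt 1))"
    by (simp add: n w_row_Suc w_row_Suc_Suc pol_add Const_add algebra_simps power2_eq_square)
  have L: "?L = {pol (py 1 ^ Suc (Suc (Suc s)) * pz 1), pol (py 1 ^ Suc (Suc s) * pz 1 ^ 2), pol (py 1 ^ Suc (Suc s) * br 1 2)}"
    by (simp add: n w_row_Suc w_row_Suc_Suc w_two_eq[unfolded One_nat_def])
  show ?thesis
  proof (rule conseq_equivI[where Q = "\<lambda>_. True"])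
    show "?f \<in> Gcarr d"
      by (intro Gcarr_add Gcarr_scale Ghom_sub_Gcarr[OF w_row_in_Ghom[OF d]]) (simp_all add: n)
    show "?L \<subseteq> Ghom d (n + 1)"
      by (simp add: n w_row_in_Ghom[OF d] w_two_in_Ghom[OF d, of "Suc (Suc s)", simplified])
    show "?L \<subseteq> T" if "is_T_ideal (G_alg d) T" "V_ideal d (\<beta>1, \<beta>2) \<subseteq> T" "?f \<in> T" for T
      using T_row_lower[OF d b_nz b_sum that(1,2) that(3)[unfolded f] c] unfolding L by simp
    show "h \<in> M" if "is_subspace (G_alg d) M" "\<And>g p. g \<in> GL d \<Longrightarrow> p \<in> M \<Longrightarrow> gl_act d g p \<in> M"
      "V_ideal d (\<beta>1, \<beta>2) \<subseteq> M" "?L \<subseteq> M" "h \<in> Ghom d (n + 1)" for M h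
    proof (rule full_component[OF d b_nz b_sum that(1,2,3), where r = "Suc s"])
      show "h \<in> Ghom d (Suc s + 3)" using that(5) by (simp add: n numeral_3_eq_3)
    qed (use that(4) in \<open>unfold L, simp_all\<close>)
  qed (use d in simp_all)
qed

lemma case_row_diff:
  assumes n: "n = Suc (Suc (Suc s))"
  shows "conseq_equiv d (\<beta>1, \<beta>2) n (w_row n (n - 1) - w_row n (n - 2))
    {w_row (n + 1) n - w_row (n + 1) (n - 1), w_two n 1 (n - 1)}"
proof -
  let ?f = "w_row n (n - 1) - w_row n (n - 2) :: 'k gelem"
    and ?L = "{w_row (n + 1) n - w_row (n + 1) (n - 1), w_two n 1 (n - 1)} :: 'k gelem set"
  have f: "?f = pol (py 1 ^ Suc s * pz 1 * tt 1)"
    by (simp add: n w_row_diff)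
  have L: "?L = {pol (py 1 ^ Suc (Suc s) * pz 1 * tt 1), pol (py 1 ^ Suc (Suc s) * br 1 2)}"
    by (simp add: n w_row_diff w_two_eq[unfolded One_nat_def])
  show ?thesis
  proof (rule conseq_equivI[where Q = "\<lambda>h. h \<in> sym_kernel d"])
    show "?f \<in> Gcarr d"
      by (intro Ghom_sub_Gcarr[OF Ghom_diff[OF w_row_in_Ghom[OF d] w_row_in_Ghom[OF d]]]) (simp_all add: n)
    show "?L \<subseteq> Ghom d (n + 1)"
      by (simp add: n Ghom_diff w_row_in_Ghom[OF d] w_two_in_Ghom[OF d, of "Suc (Suc s)", simplified])
    show "?L \<subseteq> T" if "is_T_ideal (G_alg d) T" "V_ideal d (\<beta>1, \<beta>2) \<subseteq> T" "?f \<in> T" for T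
      using T_row_diff_lower[OF d b_nz b_sum that(1,2) that(3)[unfolded f]] unfolding L by simp
    show "h \<in> sym_kernel d" if "img d (\<beta>1, \<beta>2) h \<in> T_ideal (GV d (\<beta>1, \<beta>2)) {img d (\<beta>1, \<beta>2) ?f}" for h
      using w_row_diff_in_commutator_ideal[OF d, of s, where ?'a = 'k]
      by (intro consequences_in_sym_kernel[OF d b_sum _ that]) (simp add: n)
    show "h \<in> M" if "is_subspace (G_alg d) M" "\<And>g p. g \<in> GL d \<Longrightarrow> p \<in> M \<Longrightarrow> gl_act d g p \<in> M"
      "V_ideal d (\<beta>1, \<beta>2) \<subseteq> M" "?L \<subseteq> M" "h \<in> Ghom d (n + 1)" "h \<in> sym_kernel d" for M h
    proof (rule kernel_component[OF d b_nz b_sum that(1,2,3) _ _ _ that(6), where r = "Suc s"])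
      show "h \<in> Ghom d (Suc s + 3)" using that(5) by (simp add: n numeral_3_eq_3)
    qed (use that(4) in \<open>unfold L, simp_all\<close>)
  qed (use d in simp_all)
qed

lemma case_two:
  assumes n: "n = Suc (Suc (Suc s))"
  shows "conseq_equiv d (\<beta>1, \<beta>2) n (w_two (n - 1) 1 (n - 2))
    {w_row (n + 1) (n - 1) - w_row (n + 1) (n - 2), w_two n 1 (n - 1)}"
proof -
  let ?f = "w_two (n - 1) 1 (n - 2) :: 'k gelem"
    and ?L = "{w_row (n + 1) (n - 1) - w_row (n + 1) (n - 2), w_two n 1 (n - 1)} :: 'k gelem set"
  have f: "?f = pol (py 1 ^ Suc s * br 1 2)"
    by (simp add: n w_two_eq[unfolded One_nat_def])
  have "w_row (n + 1) (n - 1) - w_row (n + 1) (n - 2) = (pol (py 1 ^ Suc s * pz 1 ^ 2 * tt 1) :: 'k gelem)"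
    by (simp add: n w_row_def pol_diff algebra_simps power2_eq_square eval_nat_numeral)
  then have L: "?L = {pol (py 1 ^ Suc s * pz 1 ^ 2 * tt 1), pol (py 1 ^ Suc (Suc s) * br 1 2)}"
    by (simp add: n w_two_eq[unfolded One_nat_def])
  show ?thesis
  proof (rule conseq_equivI[where Q = "\<lambda>h. h \<in> sym_kernel d"])
    have "w_two (Suc (Suc s)) 1 (Suc s) \<in> Gcarr d"
      by (rule Ghom_sub_Gcarr[OF w_two_in_Ghom[OF d]])
    then show "?f \<in> Gcarr d" by (simp add: n)
    show "?L \<subseteq> Ghom d (n + 1)"
      by (simp add: n Ghom_diff w_row_in_Ghom[OF d] w_two_in_Ghom[OF d, of "Suc (Suc s)", simplified])
    show "?L \<subseteq> T" if "is_T_ideal (G_alg d) T" "V_ideal d (\<beta>1, \<beta>2) \<subseteq> T" "?f \<in> T" for T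
      using T_two_lower[OF d b_nz b_sum that(1,2) that(3)[unfolded f]] unfolding L by simp
    show "h \<in> sym_kernel d" if "img d (\<beta>1, \<beta>2) h \<in> T_ideal (GV d (\<beta>1, \<beta>2)) {img d (\<beta>1, \<beta>2) ?f}" for h
      using w_two_in_commutator_ideal[OF d, of "Suc s", where ?'k = 'k]
      by (intro consequences_in_sym_kernel[OF d b_sum _ that]) (simp add: n)
    show "h \<in> M" if "is_subspace (G_alg d) M" "\<And>g p. g \<in> GL d \<Longrightarrow> p \<in> M \<Longrightarrow> gl_act d g p \<in> M"
      "V_ideal d (\<beta>1, \<beta>2) \<subseteq> M" "?L \<subseteq> M" "h \<in> Ghom d (n + 1)" "h \<in> sym_kernel d" for M h
    proof (rule kernel_component[OF d b_nz b_sum that(1,2,3) _ _ _ that(6), where r = "Suc s"])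
      show "h \<in> Ghom d (Suc s + 3)" using that(5) by (simp add: n numeral_3_eq_3)
      interpret poly_subspace "{p. pol p \<in> M}" by (rule poly_subspaceI[OF that(1)])
      \<comment> \<open>\<open>kernel_component\<close> asks for
        \<open>py 1 ^ Suc (Suc s) * pz 1 * tt 1\<close>, while the list has
        \<open>py 1 ^ Suc s * pz 1 ^ 2 * tt 1\<close>; their difference is this element of the ideal
        of the variety.\<close>
      have "pol (py 1 ^ Suc s * pz 1 * (tt 1 * tt 1)) \<in> V_ideal d (\<beta>1, \<beta>2)"
        using d by (intro T_rel2[OF d b_nz b_sum is_T_ideal_V_ideal[OF d]]) simp_all
      then have A: "py 1 ^ Suc s * pz 1 * (tt 1 * tt 1) \<in> {p. pol p \<in> M}" using that(3) by blast
      have "py 1 ^ Suc s * pz 1 ^ 2 * tt 1 \<in> {p. pol p \<in> M}" using that(4) unfolding L by simp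
      from M_add[OF A this] show "pol (py 1 ^ Suc (Suc s) * pz 1 * tt 1) \<in> M"
        by (simp add: algebra_simps power2_eq_square)
    qed (use that(4) in \<open>unfold L, simp_all\<close>)
  qed (use d in simp_all)
qed

end

theorem theorem4p9:
  fixes d :: nat and \<beta>1 \<beta>2 :: "'k::field_char_0"
  assumes "2 \<le> d" and "(\<beta>1, \<beta>2) \<noteq> (0, 0)" and "\<beta>1 + \<beta>2 = 0"
  shows
    "conseq_equiv d (\<beta>1, \<beta>2) 1 w_one {w_row 2 1, w_two 1 1 0}
   \<and> conseq_equiv d (\<beta>1, \<beta>2) 2 (w_row 2 1) {w_row 3 2, w_row 3 1, w_two 2 1 1}
   \<and> (\<forall>n \<gamma>1 \<gamma>2. 3 \<le> n \<longrightarrow> \<gamma>1 + \<gamma>2 \<noteq> 0 \<longrightarrow>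
        conseq_equiv d (\<beta>1, \<beta>2) n
          (\<gamma>1 *\<^sub>G w_row n (n - 1) + \<gamma>2 *\<^sub>G w_row n (n - 2))
          {w_row (n + 1) n, w_row (n + 1) (n - 1), w_two n 1 (n - 1)})
   \<and> (\<forall>n. 3 \<le> n \<longrightarrow>
        conseq_equiv d (\<beta>1, \<beta>2) n
          (w_row n (n - 1) - w_row n (n - 2))
          {w_row (n + 1) n - w_row (n + 1) (n - 1), w_two n 1 (n - 1)})
   \<and> (\<forall>n. 3 \<le> n \<longrightarrow>
        conseq_equiv d (\<beta>1, \<beta>2) n
          (w_two (n - 1) 1 (n - 2))
          {w_row (n + 1) (n - 1) - w_row (n + 1) (n - 2), w_two n 1 (n - 1)})"
proof -
  have n: "n = Suc (Suc (Suc (n - 3)))" if "3 \<le> n" for n :: nat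
    using that by simp
  show ?thesis
    by (intro conjI allI impI case_linear case_quadratic case_row[OF _ _ _ n] case_row_diff[OF _ _ _ n]
        case_two[OF _ _ _ n] assms)
qed

end
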